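(* Let $T$ be a closed linear operator in a complex Hilbert space $H$. (i) The approximate point spectrum, spectrum and essential spectrum satisfy $$\sigma_{\rm app}(T)\subseteq \bigcap_{B\in L(H)}W(BT,B)\subseteq \bigcap_{B\in L(H),\,0\in\rho(B)}W(BT,B)\subseteq\sigma(T)$$ and $$\sigma_e(T)=\bigcap_{B\in L(H)}W_e(BT,B).$$ (ii) Let $\Lambda\subseteq L(H)\setminus\{0\}$ and let $\Omega\subseteq\mathbb C\setminus\bigcap_{B\in\Lambda}W(BT,B)$ be a connected set. If $\Omega\cap\rho(T)\neq\emptyset$, then $\Omega\subseteq\rho(T)$ and $$\|(T-\lambda)^{-1}\|\le\inf_{B\in\Lambda}\frac{\|B\|}{\operatorname{dist}(0,W(B))\,\operatorname{dist}(\lambda,W(BT,B))},\qquad \lambda\in\Omega .$$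
   Context: $L(H)$ is the space of bounded linear operators on $H$ (everywhere defined). For a linear operator $S$ in $H$ with domain $\operatorname{dom}(S)$: $W(S)=\{\langle Sx,x\rangle: x\in\operatorname{dom}(S),\|x\|=1\}$ is the numerical range, and $W_e(S)$ is the set of all $\mu\in\mathbb C$ for which there are $x_n\in\operatorname{dom}(S)$, $\|x_n\|=1$, $x_n\to0$ weakly, with $\langle Sx_n,x_n\rangle\to\mu$. The essential spectrum $\sigma_e(S)$ is the set of all $\lambda\in\mathbb C$ for which there are $x_n\in\operatorname{dom}(S)$ with $\|x_n\|=1$, $x_n\to0$ weakly and $\|(S-\lambda)x_n\|\to0$. $\sigma_{\rm app}(S)$ is the approximate point spectrum. For linear operators $A,B$ in $H$ with $\operatorname{dom}(A)\subseteq\operatorname{dom}(B)$ (and $A-\lambda B$ defined on $\operatorname{dom}(A)$): $W(A,B)=\{\lambda\in\mathbb C: 0\in\overline{W(A-\lambda B)}\}$ and $W_e(A,B)=\{\lambda\in\mathbb C:0\in W_e(A-\lambda B)\}$. Here they are used with $A=BT$, $\operatorname{dom}(BT)=\operatorname{dom}(T)$. A quotient in the infimum with zero denominator is read as $+\infty$.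
   Formalization: The last inclusion of the first chain in (i), into σ(T), is stated only for densely defined T; without density it fails, e.g. for T the inverse of the unilateral right shift on its range, where 0 ∈ ρ(T) but 0 ∈ W(BT,B) for every boundedly invertible B. *)

theory Defs
  imports "HOL-Analysis.Analysis"
begin

text \<open>
  Complex Hilbert spaces. The inner product is linear in the first argument. The real
  scalar multiplication, norm, metric and completeness are those of \<^class>\<open>banach\<close>; the last
  axiom says that the norm is the one induced by the inner product, so definiteness
  need not be postulated separately.
\<close>

class chilbert_space = banach +
  fixes scaleC :: "complex \<Rightarrow> 'a \<Rightarrow> 'a" (infixr "*\<^sub>C" 75)
    and cinner :: "'a \<Rightarrow> 'a \<Rightarrow> complex"
  assumes scaleC_add_right: "a *\<^sub>C (x + y) = a *\<^sub>C x + a *\<^sub>C y"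
    and scaleC_add_left: "(a + b) *\<^sub>C x = a *\<^sub>C x + b *\<^sub>C x"
    and scaleC_scaleC: "a *\<^sub>C (b *\<^sub>C x) = (a * b) *\<^sub>C x"
    and scaleR_scaleC: "r *\<^sub>R x = complex_of_real r *\<^sub>C x"
    and cinner_commute: "cinner x y = cnj (cinner y x)"
    and cinner_add_left: "cinner (x + y) z = cinner x z + cinner y z"
    and cinner_scaleC_left: "cinner (a *\<^sub>C x) y = a * cinner x y"
    and cinner_self: "cinner x x = complex_of_real ((norm x)\<^sup>2)"

definition weakly_null :: "(nat \<Rightarrow> 'a::chilbert_space) \<Rightarrow> bool" where
  "weakly_null x \<longleftrightarrow> (\<forall>y. (\<lambda>n. cinner (x n) y) \<longlonglongrightarrow> 0)"

definition bounded_ops :: "('a::chilbert_space \<Rightarrow> 'a) set" where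
  "bounded_ops = {B. bounded_linear B \<and> (\<forall>c x. B (c *\<^sub>C x) = c *\<^sub>C B x)}"

text \<open>
  A (possibly unbounded) operator is given by its domain \<open>D\<close> together with a function
  whose values outside \<open>D\<close> are irrelevant: every definition below only evaluates it on \<open>D\<close>.
  The domain of a closed operator is not required to be dense. Bounded operators, i.e. the
  elements of \<^const>\<open>bounded_ops\<close>, have the domain \<^term>\<open>UNIV\<close>.
\<close>

definition linear_operator :: "'a::chilbert_space set \<Rightarrow> ('a \<Rightarrow> 'a) \<Rightarrow> bool" where
  "linear_operator D S \<longleftrightarrow>
     0 \<in> D \<and> (\<forall>x\<in>D. \<forall>y\<in>D. x + y \<in> D \<and> S (x + y) = S x + S y) \<and>
     (\<forall>c. \<forall>x\<in>D. c *\<^sub>C x \<in> D \<and> S (c *\<^sub>C x) = c *\<^sub>C S x)"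

definition closed_operator :: "'a::chilbert_space set \<Rightarrow> ('a \<Rightarrow> 'a) \<Rightarrow> bool" where
  "closed_operator D S \<longleftrightarrow> linear_operator D S \<and> closed ((\<lambda>x. (x, S x)) ` D)"

definition numerical_range :: "'a::chilbert_space set \<Rightarrow> ('a \<Rightarrow> 'a) \<Rightarrow> complex set" where
  "numerical_range D S = {cinner (S x) x | x. x \<in> D \<and> norm x = 1}"

definition ess_numerical_range :: "'a::chilbert_space set \<Rightarrow> ('a \<Rightarrow> 'a) \<Rightarrow> complex set" where
  "ess_numerical_range D S =
     {\<mu>. \<exists>x. (\<forall>n. x n \<in> D \<and> norm (x n) = 1) \<and> weakly_null x \<and>
            (\<lambda>n. cinner (S (x n)) (x n)) \<longlonglongrightarrow> \<mu>}"

text \<open>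
  In the two definitions for a pencil, \<open>D\<close> is the domain of \<open>A\<close>, which is contained in
  that of \<open>B\<close>, so that \<open>D\<close> is also the domain of \<open>A - zB\<close>.
\<close>

definition pencil_numerical_range ::
    "'a::chilbert_space set \<Rightarrow> ('a \<Rightarrow> 'a) \<Rightarrow> ('a \<Rightarrow> 'a) \<Rightarrow> complex set" where
  "pencil_numerical_range D A B =
     {z. 0 \<in> closure (numerical_range D (\<lambda>x. A x - z *\<^sub>C B x))}"

definition pencil_ess_numerical_range ::
    "'a::chilbert_space set \<Rightarrow> ('a \<Rightarrow> 'a) \<Rightarrow> ('a \<Rightarrow> 'a) \<Rightarrow> complex set" where
  "pencil_ess_numerical_range D A B =
     {z. 0 \<in> ess_numerical_range D (\<lambda>x. A x - z *\<^sub>C B x)}"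

definition approx_point_spectrum :: "'a::chilbert_space set \<Rightarrow> ('a \<Rightarrow> 'a) \<Rightarrow> complex set" where
  "approx_point_spectrum D S =
     {z. \<exists>x. (\<forall>n. x n \<in> D \<and> norm (x n) = 1) \<and>
            (\<lambda>n. norm (S (x n) - z *\<^sub>C x n)) \<longlonglongrightarrow> 0}"

definition ess_spectrum :: "'a::chilbert_space set \<Rightarrow> ('a \<Rightarrow> 'a) \<Rightarrow> complex set" where
  "ess_spectrum D S =
     {z. \<exists>x. (\<forall>n. x n \<in> D \<and> norm (x n) = 1) \<and> weakly_null x \<and>
            (\<lambda>n. norm (S (x n) - z *\<^sub>C x n)) \<longlonglongrightarrow> 0}"

text \<open>The inverse of \<open>S - z : D \<rightarrow> H\<close>, meaningful if this map is a bijection.\<close>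

definition resolvent :: "'a::chilbert_space set \<Rightarrow> ('a \<Rightarrow> 'a) \<Rightarrow> complex \<Rightarrow> 'a \<Rightarrow> 'a" where
  "resolvent D S z = inv_into D (\<lambda>x. S x - z *\<^sub>C x)"

definition resolvent_set :: "'a::chilbert_space set \<Rightarrow> ('a \<Rightarrow> 'a) \<Rightarrow> complex set" where
  "resolvent_set D S =
     {z. bij_betw (\<lambda>x. S x - z *\<^sub>C x) D UNIV \<and> resolvent D S z \<in> bounded_ops}"

definition spectrum :: "'a::chilbert_space set \<Rightarrow> ('a \<Rightarrow> 'a) \<Rightarrow> complex set" where
  "spectrum D S = - resolvent_set D S"

text \<open>
  Unlike \<^const>\<open>infdist\<close>, this distance to the empty set is \<open>\<infinity>\<close> rather than 0.
\<close>

definition ext_dist :: "complex \<Rightarrow> complex set \<Rightarrow> ereal" where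
  "ext_dist z M = (INF w\<in>M. ereal (dist z w))"

text \<open>Quotients with denominator 0 are \<open>\<infinity>\<close>, also for the numerator 0.\<close>

definition ext_quotient :: "ereal \<Rightarrow> ereal \<Rightarrow> ereal" where
  "ext_quotient a b = (if b = 0 then \<infinity> else a / b)"

end

theory Submission
  imports Defs
begin

text \<open>
  A singular sequence for \<open>T - \<lambda>\<close> is mapped by every bounded \<open>B\<close> to a null sequence, which gives
  the inclusions of the spectra in the pencil numerical ranges. Conversely, if \<open>\<lambda> \<notin> \<sigma>\<^sub>e(T)\<close>, then
  \<open>T - \<lambda>\<close> is bounded below on the orthogonal complement in its domain of a finite orthonormal set,
  and a bounded left inverse \<open>B\<close> there makes \<open>B(T - \<lambda>)\<close> a finite-rank perturbation of the identity, so
  \<open>\<langle>B(T - \<lambda>)x\<^sub>n, x\<^sub>n\<rangle> \<rightarrow> 1\<close> along weakly null unit sequences. If \<open>\<lambda> \<in> \<rho>(T)\<close> and \<open>T\<close> is densely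
  defined, then the resolvent \<open>R\<close> has a polar decomposition \<open>U|R|\<close> with unitary \<open>U\<close>, and \<open>B = U\<close>
  separates \<open>W(B(T - \<lambda>))\<close> from 0.

  For (ii), \<open>\<lambda> \<notin> W(BT,B)\<close> makes \<open>T - \<lambda>\<close> bounded below, so \<open>\<Omega> \<inter> \<rho>(T)\<close> is open and closed in \<open>\<Omega>\<close>. For
  a unit vector \<open>x\<close> the quotient \<open>w = \<langle>BTx,x\<rangle> / \<langle>Bx,x\<rangle>\<close> belongs to \<open>W(BT,B)\<close>, and the estimate follows
  from \<open>\<langle>B(T - \<lambda>)x,x\<rangle> = (w - \<lambda>)\<langle>Bx,x\<rangle>\<close>.
\<close>

section \<open>Complex Hilbert spaces\<close>

text \<open>For complex scalars the norm is accessible only through the inner product, so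
  homogeneity is read off from \<open>cinner (a *\<^sub>C x) (a *\<^sub>C x)\<close>.\<close>

lemma norm_scaleC: "norm (a *\<^sub>C (x::'a::chilbert_space)) = cmod a * norm x"
proof -
  have "complex_of_real ((norm (a *\<^sub>C x))\<^sup>2) = a * (cnj a * cinner x x)"
    by (metis cinner_self cinner_scaleC_left cinner_commute complex_cnj_mult)
  also have "\<dots> = complex_of_real ((cmod a * norm x)\<^sup>2)"
    by (simp add: cinner_self power_mult_distrib complex_norm_square mult.assoc del: of_real_power)
  finally show ?thesis
    by (simp only: of_real_eq_iff) (simp add: power2_eq_iff_nonneg)
qed

interpretation scaleC: bounded_bilinear "scaleC :: complex \<Rightarrow> 'a::chilbert_space \<Rightarrow> 'a"
proof
  show "\<exists>K. \<forall>a x. norm (a *\<^sub>C (x::'a)) \<le> norm a * norm x * K"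
    by (rule exI[of _ 1]) (simp add: norm_scaleC)
qed (auto simp: scaleC_add_right scaleC_add_left scaleR_scaleC scaleC_scaleC mult.commute scaleR_conv_of_real)

lemma scaleC_one [simp]: "1 *\<^sub>C (x::'a::chilbert_space) = x"
  by (metis of_real_1 scaleR_one scaleR_scaleC)

lemma scaleC_minus_one: "(-1) *\<^sub>C (x::'a::chilbert_space) = - x"
  by (metis of_real_1 of_real_minus scaleR_minus1_left scaleR_scaleC)

lemma cinner_add_right: "cinner x (y + z) = cinner x y + cinner x z"
  by (metis cinner_add_left cinner_commute complex_cnj_add)

lemma cinner_scaleC_right: "cinner x (a *\<^sub>C y) = cnj a * cinner x y"
  by (metis cinner_commute cinner_scaleC_left complex_cnj_mult)

lemma cinner_diff_left: "cinner (x - y) z = cinner x z - cinner y z"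
  by (metis add_diff_cancel_right' cinner_add_left diff_add_cancel)

lemma cinner_diff_right: "cinner x (y - z) = cinner x y - cinner x z"
  by (metis add_diff_cancel_right' cinner_add_right diff_add_cancel)

lemma Re_cinner_self [simp]: "Re (cinner x x) = (norm x)\<^sup>2"
  by (simp add: cinner_self)

lemma norm_diff_sq:
  "(norm (x - y))\<^sup>2 = (norm x)\<^sup>2 - 2 * Re (cinner x y) + (norm (y::'a::chilbert_space))\<^sup>2"
proof -
  have "(norm (x - y))\<^sup>2 = Re (cinner (x - y) (x - y))" by simp
  also have "\<dots> = (norm x)\<^sup>2 - Re (cinner x y) - Re (cinner y x) + (norm y)\<^sup>2"
    by (simp only: cinner_diff_left cinner_diff_right) simp
  also have "Re (cinner y x) = Re (cinner x y)" by (metis cinner_commute complex_cnj cnj.sel(1))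
  finally show ?thesis by simp
qed

lemma norm_add_sq:
  "(norm (x + y))\<^sup>2 = (norm x)\<^sup>2 + 2 * Re (cinner x y) + (norm (y::'a::chilbert_space))\<^sup>2"
  using norm_diff_sq[of x "- y"] cinner_scaleC_right[of x "-1" y] by (simp add: scaleC_minus_one)

text \<open>The subtracted vector is the orthogonal projection of \<open>x\<close> onto the line
  through \<open>v\<close>. Nonnegativity of the right-hand side is the Cauchy-Schwarz inequality;
  the strict decrease for nonzero \<open>cinner x v\<close> forces a best approximation to be
  orthogonal.\<close>

lemma norm_sub_projection_sq:
  assumes "v \<noteq> 0"
  shows "(norm (x - (cinner x v / complex_of_real ((norm v)\<^sup>2)) *\<^sub>C v))\<^sup>2
    = (norm x)\<^sup>2 - (cmod (cinner x v))\<^sup>2 / (norm (v::'a::chilbert_space))\<^sup>2"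
proof -
  define t where "t = cinner x v / complex_of_real ((norm v)\<^sup>2)"
  have v: "norm v > 0" using assms by simp
  have 1: "cmod t = cmod (cinner x v) / (norm v)\<^sup>2"
    unfolding t_def norm_divide by (simp del: of_real_power)
  have "cnj t * cinner x v = complex_of_real ((cmod (cinner x v))\<^sup>2) / complex_of_real ((norm v)\<^sup>2)"
    by (simp add: t_def complex_norm_square mult.commute del: of_real_power)
  then have 2: "Re (cinner x (t *\<^sub>C v)) = (cmod (cinner x v))\<^sup>2 / (norm v)\<^sup>2"
    by (simp add: cinner_scaleC_right del: of_real_power flip: of_real_divide)
  have "(norm (x - t *\<^sub>C v))\<^sup>2 = (norm x)\<^sup>2 - (cmod (cinner x v))\<^sup>2 / (norm v)\<^sup>2"
    unfolding norm_diff_sq 2 norm_scaleC 1 using v by (simp add: field_simps power2_eq_square)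
  then show ?thesis by (simp add: t_def)
qed

lemma cinner_Cauchy_Schwarz: "cmod (cinner x y) \<le> norm x * norm (y::'a::chilbert_space)"
proof (cases "y = 0")
  case True
  then show ?thesis using cinner_scaleC_right[of x 0 y] by (simp add: scaleC.zero_left)
next
  case False
  have "0 \<le> (norm x)\<^sup>2 - (cmod (cinner x y))\<^sup>2 / (norm y)\<^sup>2"
    using norm_sub_projection_sq[OF False, of x] by (metis zero_le_power2)
  then have "(cmod (cinner x y))\<^sup>2 \<le> (norm x * norm y)\<^sup>2"
    using False by (simp add: field_simps power_mult_distrib)
  then show ?thesis by (simp add: power2_le_iff_abs_le)
qed

interpretation cinner: bounded_bilinear "cinner :: 'a::chilbert_space \<Rightarrow> 'a \<Rightarrow> complex"
proof
  show "\<exists>K. \<forall>x y. cmod (cinner x (y::'a)) \<le> norm x * norm y * K"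
    by (rule exI[of _ 1]) (simp add: cinner_Cauchy_Schwarz)
qed (auto simp: cinner_add_left cinner_add_right scaleR_scaleC cinner_scaleC_left
      cinner_scaleC_right scaleR_conv_of_real)

lemma cinner_eq_0_all: "(\<And>y. cinner x y = 0) \<Longrightarrow> x = (0::'a::chilbert_space)"
  by (metis Re_cinner_self norm_eq_zero power_eq_0_iff zero_complex.sel(1))

section \<open>Orthogonal projections and the Riesz representation theorem\<close>

definition csubspace :: "'a::chilbert_space set \<Rightarrow> bool" where
  "csubspace M \<longleftrightarrow> 0 \<in> M \<and> (\<forall>x\<in>M. \<forall>y\<in>M. x + y \<in> M) \<and> (\<forall>c. \<forall>x\<in>M. c *\<^sub>C x \<in> M)"

lemma csubspace_closure:
  assumes "csubspace M"
  shows "csubspace (closure M)"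
  unfolding csubspace_def
proof (intro conjI ballI allI)
  show "0 \<in> closure M" using assms closure_subset unfolding csubspace_def by blast
next
  fix x y assume "x \<in> closure M" "y \<in> closure M"
  then obtain a b where "\<And>n. a n \<in> M" "a \<longlonglongrightarrow> x" "\<And>n. b n \<in> M" "b \<longlonglongrightarrow> y"
    unfolding closure_sequential by blast
  then have "(\<forall>n. a n + b n \<in> M) \<and> (\<lambda>n. a n + b n) \<longlonglongrightarrow> x + y"
    using assms by (auto simp: csubspace_def intro: tendsto_intros)
  then show "x + y \<in> closure M"
    unfolding closure_sequential by (intro exI[of _ "\<lambda>n. a n + b n"])
next
  fix c x assume "x \<in> closure M"
  then obtain a where "\<And>n. a n \<in> M" "a \<longlonglongrightarrow> x"
    unfolding closure_sequential by blast
  then have "(\<forall>n. c *\<^sub>C a n \<in> M) \<and> (\<lambda>n. c *\<^sub>C a n) \<longlonglongrightarrow> c *\<^sub>C x"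
    using assms by (auto simp: csubspace_def intro: scaleC.tendsto)
  then show "c *\<^sub>C x \<in> closure M"
    unfolding closure_sequential by (intro exI[of _ "\<lambda>n. c *\<^sub>C a n"])
qed

text \<open>A minimising sequence for the distance from \<open>x\<close> to \<open>M\<close> is
  Cauchy by the parallelogram law, and its limit is the projection.\<close>

lemma orthogonal_projection_exists:
  fixes M :: "'a::chilbert_space set"
  assumes "closed M" "csubspace M"
  shows "\<exists>m\<in>M. \<forall>v\<in>M. cinner (x - m) v = 0"
proof -
  define d where "d = infdist x M"
  have M0: "M \<noteq> {}" using assms by (auto simp: csubspace_def)
  have dle: "d \<le> norm (x - v)" if "v \<in> M" for v
    unfolding d_def using infdist_le[OF that, of x] by (simp add: dist_norm)
  have d0: "d \<ge> 0" by (simp add: d_def infdist_nonneg)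
  have "\<exists>v\<in>M. norm (x - v) < d + e" if "e > 0" for e
  proof -
    have "(INF a\<in>M. dist x a) < d + e" using M0 that by (simp add: d_def infdist_def)
    then show ?thesis
      by (subst (asm) cINF_less_iff) (auto simp: M0 dist_norm intro: bdd_belowI2[where m=0])
  qed
  then have "\<forall>n. \<exists>v\<in>M. norm (x - v) < d + inverse (real (Suc n))" by simp
  then obtain m where mM: "\<And>n. m n \<in> M" and m: "\<And>n. norm (x - m n) < d + inverse (real (Suc n))"
    by metis
  have lim: "(\<lambda>n. d + inverse (real (Suc n))) \<longlonglongrightarrow> d + 0"
    by (intro tendsto_intros LIMSEQ_inverse_real_of_nat)
  have nlim: "(\<lambda>n. norm (x - m n)) \<longlonglongrightarrow> d"
    by (rule tendsto_sandwich[OF _ _ tendsto_const, of d]) (use m lim dle mM in \<open>auto intro: always_eventually less_imp_le\<close>)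
  \<comment> \<open>The midpoint of \<open>m k\<close> and \<open>m l\<close> lies in
    \<open>M\<close>, so \<open>norm (a + b)\<close> is at least \<open>2 * d\<close> in the
    parallelogram law for the two errors \<open>a\<close> and \<open>b\<close>.\<close>
  have par: "(norm (m k - m l))\<^sup>2 \<le> 2 * ((norm (x - m k))\<^sup>2 - d\<^sup>2) + 2 * ((norm (x - m l))\<^sup>2 - d\<^sup>2)" for k l
  proof -
    define a b where "a = x - m k" and "b = x - m l"
    have "(1/2) *\<^sub>R (m k + m l) \<in> M"
      using mM assms(2) by (auto simp: csubspace_def scaleR_scaleC)
    then have "d \<le> norm (x - (1/2) *\<^sub>R (m k + m l))" by (rule dle)
    also have "x - (1/2) *\<^sub>R (m k + m l) = (1/2) *\<^sub>R (a + b)"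
      using scaleR_half_double[of x] by (simp add: a_def b_def algebra_simps)
    finally have "2 * d \<le> norm (a + b)" by simp
    then have "(2 * d)\<^sup>2 \<le> (norm (a + b))\<^sup>2" using d0 by (intro power_mono) auto
    moreover have "norm (m k - m l) = norm (a - b)" by (simp add: a_def b_def norm_minus_commute)
    ultimately show ?thesis
      unfolding a_def[symmetric] b_def[symmetric]
      using norm_diff_sq[of a b] norm_add_sq[of a b] by (simp add: power_mult_distrib)
  qed
  have "Cauchy m"
  proof (rule metric_CauchyI)
    fix e :: real assume e: "e > 0"
    have "(\<lambda>n. (norm (x - m n))\<^sup>2 - d\<^sup>2) \<longlonglongrightarrow> d\<^sup>2 - d\<^sup>2" by (intro tendsto_intros nlim)
    then have "eventually (\<lambda>n. (norm (x - m n))\<^sup>2 - d\<^sup>2 < e\<^sup>2 / 4) sequentially"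
      by (rule order_tendstoD) (use e in simp)
    then obtain N where N: "\<And>n. n \<ge> N \<Longrightarrow> (norm (x - m n))\<^sup>2 - d\<^sup>2 < e\<^sup>2 / 4"
      unfolding eventually_sequentially by blast
    have "dist (m k) (m l) < e" if "k \<ge> N" "l \<ge> N" for k l
    proof -
      have "(norm (m k - m l))\<^sup>2 < e\<^sup>2" using par[of k l] N[OF that(1)] N[OF that(2)] by simp
      then show ?thesis using e by (simp add: dist_norm power_less_imp_less_base)
    qed
    then show "\<exists>N. \<forall>k\<ge>N. \<forall>l\<ge>N. dist (m k) (m l) < e" by blast
  qed
  then obtain p where p: "m \<longlonglongrightarrow> p" using Cauchy_convergent convergent_def by blast
  have pM: "p \<in> M" using closed_sequentially[OF assms(1)] mM p by blast
  have "(\<lambda>n. norm (x - m n)) \<longlonglongrightarrow> norm (x - p)" by (intro tendsto_intros p)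
  with nlim have np: "norm (x - p) = d" using LIMSEQ_unique by blast
  have "cinner (x - p) v = 0" if v: "v \<in> M" for v
  proof (cases "v = 0")
    case False
    \<comment> \<open>Moving \<open>p\<close> by this multiple of \<open>v\<close> would lower the
      squared distance by \<open>|cinner (x - p) v|^2 / |v|^2\<close>, which minimality of
      \<open>d\<close> rules out unless the inner product vanishes.\<close>
    let ?t = "cinner (x - p) v / complex_of_real ((norm v)\<^sup>2)"
    have "p + ?t *\<^sub>C v \<in> M" using pM v assms(2) by (auto simp: csubspace_def)
    then have "norm (x - p) \<le> norm (x - p - ?t *\<^sub>C v)" using dle np by (simp add: diff_diff_eq)
    then have "(norm (x - p))\<^sup>2 \<le> (norm (x - p - ?t *\<^sub>C v))\<^sup>2" by (intro power_mono) auto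
    then have "(cmod (cinner (x - p) v))\<^sup>2 / (norm v)\<^sup>2 \<le> 0"
      unfolding norm_sub_projection_sq[OF False] by simp
    then show ?thesis using False by (simp add: divide_le_0_iff)
  qed (simp add: cinner.zero_right)
  then show ?thesis using pM by blast
qed

text \<open>A vector \<open>v\<close> orthogonal to the kernel of \<open>f\<close> represents
  \<open>f\<close> up to a factor: \<open>x - (f x / f v) *\<^sub>C v\<close> lies in the kernel,
  and pairing it with \<open>v\<close> determines \<open>f x\<close>.\<close>

lemma Riesz_representation:
  fixes f :: "'a::chilbert_space \<Rightarrow> complex"
  assumes f: "bounded_linear f" and fC: "\<And>c x. f (c *\<^sub>C x) = c * f x"
  shows "\<exists>u. \<forall>x. f x = cinner x u"
proof (cases "\<forall>x. f x = 0")
  case True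
  then show ?thesis by (intro exI[of _ 0]) (simp add: cinner.zero_right)
next
  case False
  interpret f: bounded_linear f by (rule f)
  obtain x0 where x0: "f x0 \<noteq> 0" using False by blast
  define M where "M = f -` {0}"
  have "closed M" unfolding M_def by (intro closed_vimage f.continuous_on continuous_on_id) auto
  moreover have "csubspace M" by (auto simp: csubspace_def M_def fC f.add f.zero)
  ultimately obtain m where m: "m \<in> M" "\<And>v. v \<in> M \<Longrightarrow> cinner (x0 - m) v = 0"
    using orthogonal_projection_exists by blast
  define v where "v = x0 - m"
  have fv: "f v = f x0" using m(1) by (simp add: v_def M_def f.diff)
  then have v0: "v \<noteq> 0" using x0 f.zero by auto
  have ort: "cinner w v = 0" if "f w = 0" for w
    using m(2)[of w] that cinner_commute[of w v] by (simp add: v_def M_def)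
  have "f x = cinner x ((cnj (f v) / complex_of_real ((norm v)\<^sup>2)) *\<^sub>C v)" for x
  proof -
    have "cinner (x - (f x / f v) *\<^sub>C v) v = 0"
      by (rule ort) (use fv x0 in \<open>simp add: f.diff fC\<close>)
    then have "cinner x v = f x / f v * complex_of_real ((norm v)\<^sup>2)"
      by (simp add: cinner_diff_left cinner_scaleC_left cinner_self del: of_real_power)
    then show ?thesis using v0 fv x0 by (simp add: cinner_scaleC_right del: of_real_power)
  qed
  then show ?thesis by blast
qed

section \<open>Bounded operators and square roots\<close>

lemma bounded_opsI:
  assumes "\<And>x y. B (x + y) = B x + B y" "\<And>c x. B (c *\<^sub>C x) = c *\<^sub>C B x"
    "\<And>x. norm (B x) \<le> K * norm (x::'a::chilbert_space)"
  shows "B \<in> bounded_ops"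
  unfolding bounded_ops_def using assms
  by (auto intro!: bounded_linear_intro[where K=K] simp: scaleR_scaleC mult.commute)

lemma bounded_opsD:
  assumes "B \<in> bounded_ops"
  shows "bounded_linear B" "B (c *\<^sub>C x) = c *\<^sub>C B x"
    "B (x + y) = B x + B y" "B (x - y) = B x - B y" "B 0 = 0"
  using assms unfolding bounded_ops_def
  by (auto simp: linear_simps)

lemma bounded_ops_comp: "A \<in> bounded_ops \<Longrightarrow> B \<in> bounded_ops \<Longrightarrow> (\<lambda>x. A (B x)) \<in> bounded_ops"
  unfolding bounded_ops_def by (auto intro: bounded_linear_compose)

lemma bounded_ops_tendsto: "B \<in> bounded_ops \<Longrightarrow> (f \<longlongrightarrow> l) F \<Longrightarrow> ((\<lambda>n. B (f n)) \<longlongrightarrow> B l) F"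
  by (rule bounded_linear.tendsto[OF bounded_opsD(1)])

text \<open>\<open>S' y\<close> is the Riesz vector of the functional sending \<open>x\<close> to
  \<open>cinner (S x) y\<close>. Its uniqueness yields linearity, and testing with
  \<open>x = S' y\<close> yields the bound.\<close>

lemma adjoint_exists:
  assumes S: "S \<in> bounded_ops"
  shows "\<exists>S'\<in>bounded_ops. \<forall>x y. cinner (S x) y = cinner (x::'a::chilbert_space) (S' y)"
proof -
  have "\<exists>u. \<forall>x. cinner (S x) y = cinner x u" for y
    by (rule Riesz_representation)
      (auto intro!: bounded_linear_compose[OF cinner.bounded_linear_left] bounded_opsD(1)[OF S]
         simp: bounded_opsD(2)[OF S] cinner_scaleC_left)
  then obtain S' where S': "\<And>x y. cinner (S x) y = cinner x (S' y)" by metis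
  have eqI: "u = v" if "\<And>x. cinner x u = cinner x v" for u v :: 'a
    using cinner_eq_0_all[of "u - v"] that by (metis cinner_commute cinner_diff_right diff_self eq_iff_diff_eq_0 complex_cnj_zero)
  obtain K where K: "\<And>x. norm (S x) \<le> norm x * K" "K > 0"
    using bounded_linear.pos_bounded[OF bounded_opsD(1)[OF S]] by metis
  have "norm (S' y) \<le> K * norm y" for y
  proof -
    have "(norm (S' y))\<^sup>2 = Re (cinner (S (S' y)) y)" by (simp add: S')
    also have "\<dots> \<le> norm (S (S' y)) * norm y"
      using cinner_Cauchy_Schwarz complex_Re_le_cmod order_trans by blast
    also have "\<dots> \<le> (norm (S' y) * K) * norm y" by (intro mult_right_mono K) auto
    finally have "norm (S' y) * norm (S' y) \<le> norm (S' y) * (K * norm y)" by (simp add: power2_eq_square mult_ac)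
    then show ?thesis using K(2) by (cases "S' y = 0") (auto simp: mult_le_cancel_left)
  qed
  then have "S' \<in> bounded_ops"
    by (intro bounded_opsI) (auto intro!: eqI simp: cinner_add_right cinner_scaleC_right simp flip: S')
  then show ?thesis using S' by blast
qed

section \<open>Square roots and polar decompositions\<close>

primrec sqrt_iter :: "('a::chilbert_space \<Rightarrow> 'a) \<Rightarrow> nat \<Rightarrow> 'a \<Rightarrow> 'a" where
  "sqrt_iter Q 0 = (\<lambda>x. 0)"
| "sqrt_iter Q (Suc n) = (\<lambda>x. (1/2) *\<^sub>R (Q x + sqrt_iter Q n (sqrt_iter Q n x)))"

primrec sqrt_majorant :: "nat \<Rightarrow> real" where
  "sqrt_majorant 0 = 0"
| "sqrt_majorant (Suc n) = (1 + (sqrt_majorant n)\<^sup>2) / 2"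

lemma sqrt_majorant_bounds: "0 \<le> sqrt_majorant n \<and> sqrt_majorant n \<le> 1"
proof (induction n)
  case (Suc n)
  then have "(sqrt_majorant n)\<^sup>2 \<le> 1" by (simp add: power_le_one)
  then show ?case by simp
qed simp

lemma sqrt_majorant_mono: "mono sqrt_majorant"
proof (rule mono_iff_le_Suc[THEN iffD2], rule allI)
  fix n
  \<comment> \<open>Half of this square is the increment of the scalar iteration.\<close>
  have "0 \<le> (1 - sqrt_majorant n)\<^sup>2" by simp
  then show "sqrt_majorant n \<le> sqrt_majorant (Suc n)"
    by (simp add: power2_diff)
qed

text \<open>The fixed points of \<open>R \<mapsto> (Q + R\<^sup>2)/2\<close> satisfy \<open>(1 - R)\<^sup>2 = 1 - Q\<close>. The iterates
  converge in norm because their differences are dominated by those of the scalar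
  iteration with \<open>Q = 1\<close>, which increases to 1.\<close>

lemma sqrt_fixed_point:
  fixes Q :: "'a::chilbert_space \<Rightarrow> 'a"
  assumes Q: "Q \<in> bounded_ops" and Qle: "\<And>x. norm (Q x) \<le> norm x"
    and Qsym: "\<And>x y. cinner (Q x) y = cinner x (Q y)"
  shows "\<exists>R\<in>bounded_ops. (\<forall>x. norm (R x) \<le> norm x) \<and>
    (\<forall>x y. cinner (R x) y = cinner x (R y)) \<and> (\<forall>x. Q x + R (R x) = R x + R x)"
proof -
  let ?R = "sqrt_iter Q" and ?r = sqrt_majorant
  have add: "?R n (x + y) = ?R n x + ?R n y" for n x y
    by (induction n arbitrary: x y) (simp_all add: bounded_opsD(3)[OF Q] algebra_simps)
  have hom: "?R n (c *\<^sub>C x) = c *\<^sub>C ?R n x" for n c x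
    by (induction n arbitrary: x)
      (simp_all add: bounded_opsD(2)[OF Q] scaleR_scaleC scaleC_scaleC scaleC_add_right scaleC.zero_right mult.commute)
  have diff: "?R n (x - y) = ?R n x - ?R n y" for n x y
    using add[of n "x - y" y] by (simp add: algebra_simps)
  have sym: "cinner (?R n x) y = cinner x (?R n y)" for n x y
    by (induction n arbitrary: x y)
      (simp_all add: Qsym cinner.zero_left cinner.zero_right cinner.scaleR_left cinner.scaleR_right
        cinner_add_left cinner_add_right)
  have bnd: "norm (?R n x) \<le> ?r n * norm x" for n x
  proof (induction n arbitrary: x)
    case (Suc n)
    have "norm (?R n (?R n x)) \<le> ?r n * (?r n * norm x)"
      using Suc[of "?R n x"] Suc[of x] sqrt_majorant_bounds[of n]
      by (meson mult_left_mono order_trans)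
    then have "norm (Q x + ?R n (?R n x)) \<le> norm x + (?r n)\<^sup>2 * norm x"
      using Qle[of x] norm_triangle_ineq[of "Q x" "?R n (?R n x)"] by (simp add: power2_eq_square)
    moreover have "norm (?R (Suc n) x) = norm (Q x + ?R n (?R n x)) / 2" by simp
    ultimately show ?case by (simp add: algebra_simps del: sqrt_iter.simps)
  qed simp
  have bnd1: "norm (?R n x) \<le> norm x" for n x
    using bnd[of n x] sqrt_majorant_bounds[of n] mult_right_mono[of "?r n" 1 "norm x"] by simp
  have step: "norm (?R (Suc n) x - ?R n x) \<le> (?r (Suc n) - ?r n) * norm x" for n x
  proof (induction n arbitrary: x)
    case 0
    then show ?case using Qle[of x] by simp
  next
    case (Suc n)
    define d where "d = ?R (Suc n) x - ?R n x"
    have "?R (Suc (Suc n)) x - ?R (Suc n) x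
        = (1/2) *\<^sub>R (?R (Suc n) (?R (Suc n) x) - ?R n (?R n x))"
      unfolding sqrt_iter.simps(2)[of Q "Suc n"]
      by (subst (3) sqrt_iter.simps(2)) (simp add: algebra_simps del: sqrt_iter.simps)
    \<comment> \<open>With \<open>R\<close> and \<open>R'\<close> for consecutive iterates, the
      difference of their squares is written as \<open>(R' - R) R' + R (R' - R)\<close>, a form that
      does not ask them to commute. The induction hypothesis is applied at \<open>R' x\<close> and
      at \<open>x\<close>.\<close>
    also have "?R (Suc n) (?R (Suc n) x) - ?R n (?R n x)
        = (?R (Suc n) (?R (Suc n) x) - ?R n (?R (Suc n) x)) + ?R n d"
      by (simp add: d_def diff)
    finally have "norm (?R (Suc (Suc n)) x - ?R (Suc n) x)
        \<le> (norm (?R (Suc n) (?R (Suc n) x) - ?R n (?R (Suc n) x)) + norm (?R n d)) / 2"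
      using norm_triangle_ineq by (simp del: sqrt_iter.simps)
    moreover have "norm (?R (Suc n) (?R (Suc n) x) - ?R n (?R (Suc n) x))
        \<le> (?r (Suc n) - ?r n) * (?r (Suc n) * norm x)"
      by (rule order_trans[OF Suc]) (intro mult_left_mono bnd, use monoD[OF sqrt_majorant_mono, of n "Suc n"] in linarith)
    moreover have "norm (?R n d) \<le> ?r n * ((?r (Suc n) - ?r n) * norm x)"
      unfolding d_def
      by (rule order_trans[OF bnd]) (intro mult_left_mono Suc, use sqrt_majorant_bounds in blast)
    ultimately have "norm (?R (Suc (Suc n)) x - ?R (Suc n) x)
        \<le> ((?r (Suc n) - ?r n) * (?r (Suc n) * norm x) + ?r n * ((?r (Suc n) - ?r n) * norm x)) / 2"
      by argo
    also have "\<dots> = ((1 + (?r (Suc n))\<^sup>2) / 2 - (1 + (?r n)\<^sup>2) / 2) * norm x"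
      by (simp add: power2_eq_square algebra_simps add_divide_distrib diff_divide_distrib del: sqrt_majorant.simps)
    finally show ?case by simp
  qed
  have cau: "norm (?R (n + k) x - ?R n x) \<le> (?r (n + k) - ?r n) * norm x" for n k x
  proof (induction k)
    case (Suc k)
    then show ?case
      using step[of "n + k" x] norm_triangle_ineq[of "?R (Suc (n + k)) x - ?R (n + k) x" "?R (n + k) x - ?R n x"]
      by (simp add: algebra_simps del: sqrt_iter.simps sqrt_majorant.simps)
  qed simp
  have "Bseq ?r" by (rule BseqI'[where K=1]) (use sqrt_majorant_bounds in auto)
  then have "Cauchy ?r"
    using Bseq_mono_convergent convergent_Cauchy sqrt_majorant_mono by (metis monoD)
  have "Cauchy (\<lambda>n. ?R n x)" for x
  proof (rule CauchyI')
    fix e :: real assume e: "e > 0"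
    \<comment> \<open>The summand 1 in the denominator keeps it positive when
      \<open>x = 0\<close>.\<close>
    then obtain N where N: "\<And>m n. m \<ge> N \<Longrightarrow> n \<ge> N \<Longrightarrow> norm (?r m - ?r n) < e / (norm x + 1)"
      using CauchyD[OF \<open>Cauchy ?r\<close>, of "e / (norm x + 1)"] by (auto simp: add_nonneg_pos)
    have "dist (?R m x) (?R n x) < e" if mn: "m \<ge> N" "n > m" for m n
    proof -
      obtain k where k: "n = m + k" using mn less_imp_add_positive by blast
      have "norm (?R n x - ?R m x) \<le> (?r n - ?r m) * norm x" using cau[of m k x] k by simp
      also have "\<dots> \<le> (e / (norm x + 1)) * norm x"
        using N[of n m] mn by (intro mult_right_mono) auto
      also have "\<dots> < e"
        using e add_nonneg_pos[of "norm x" 1] by (simp add: pos_divide_less_eq algebra_simps)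
      finally show ?thesis by (simp add: dist_norm norm_minus_commute)
    qed
    then show "\<exists>M. \<forall>m\<ge>M. \<forall>n>m. dist (?R m x) (?R n x) < e" by blast
  qed
  then have "\<exists>l. (\<lambda>n. ?R n x) \<longlonglongrightarrow> l" for x
    using Cauchy_convergent convergent_def by blast
  then obtain R where lim: "\<And>x. (\<lambda>n. ?R n x) \<longlonglongrightarrow> R x" by metis
  have Rle: "norm (R x) \<le> norm x" for x
    by (rule LIMSEQ_le_const2[OF tendsto_norm[OF lim]]) (use bnd1 in blast)
  have "R \<in> bounded_ops"
  proof (rule bounded_opsI)
    show "R (x + y) = R x + R y" for x y
      by (rule LIMSEQ_unique[OF lim]) (simp add: add tendsto_add lim)
    show "R (c *\<^sub>C x) = c *\<^sub>C R x" for c x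
      by (rule LIMSEQ_unique[OF lim]) (simp add: hom lim scaleC.tendsto)
    show "norm (R x) \<le> 1 * norm x" for x using Rle by simp
  qed
  moreover have "cinner (R x) y = cinner x (R y)" for x y
    using LIMSEQ_unique[OF cinner.tendsto[OF lim[of x] tendsto_const[of y]]]
      cinner.tendsto[OF tendsto_const[of x] lim[of y]] by (simp add: sym)
  moreover have "Q x + R (R x) = R x + R x" for x
  proof -
    \<comment> \<open>Since all iterates are contractions, replacing the moving argument
      \<open>?R n x\<close> by its limit \<open>R x\<close> costs only a null sequence.\<close>
    have "(\<lambda>n. ?R n (?R n x - R x)) \<longlonglongrightarrow> 0"
      by (rule Lim_null_comparison[OF _ tendsto_norm_zero[OF LIM_zero[OF lim[of x]]]])
        (auto intro: always_eventually bnd1)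
    from tendsto_add[OF this lim[of "R x"]] have "(\<lambda>n. ?R n (?R n x)) \<longlonglongrightarrow> R (R x)"
      by (simp add: diff)
    then have "(\<lambda>n. ?R (Suc n) x) \<longlonglongrightarrow> (1/2) *\<^sub>R (Q x + R (R x))"
      unfolding sqrt_iter.simps by (intro tendsto_intros)
    with LIMSEQ_Suc[OF lim[of x]] have "R x = (1/2) *\<^sub>R (Q x + R (R x))"
      using LIMSEQ_unique by blast
    then have "R x + R x = (1/2) *\<^sub>R (Q x + R (R x)) + (1/2) *\<^sub>R (Q x + R (R x))" by simp
    then show ?thesis by (simp flip: scaleR_left_distrib)
  qed
  ultimately show ?thesis using Rle by blast
qed

text \<open>By \<open>eq\<close>, sending \<open>A x\<close> to \<open>S x\<close> is well defined
  and isometric from one dense subspace onto another; \<open>U\<close> is its extension by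
  limits.\<close>

lemma isometric_extension:
  fixes A S :: "'a::chilbert_space \<Rightarrow> 'a"
  assumes A: "A \<in> bounded_ops" and S: "S \<in> bounded_ops"
    and eq: "\<And>x y. cinner (A x) (A y) = cinner (S x) (S y)"
    and dA: "closure (range A) = UNIV" and dS: "closure (range S) = UNIV"
  shows "\<exists>U\<in>bounded_ops. surj U \<and> (\<forall>x. U (A x) = S x) \<and> (\<forall>x y. cinner (U x) (U y) = cinner x y)"
proof -
  have eqn: "norm (A x) = norm (S x)" for x
    using eq[of x x] by (metis Re_cinner_self norm_ge_zero power2_eq_imp_eq)
  have dist: "dist (A x) (A y) = dist (S x) (S y)" for x y
    by (metis bounded_opsD(4)[OF A] bounded_opsD(4)[OF S] dist_norm eqn)
  have app: "\<exists>a. (\<lambda>n. F (a n)) \<longlonglongrightarrow> y" if "closure (range F) = UNIV" for F :: "'a \<Rightarrow> 'a" and y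
  proof -
    have "y \<in> closure (range F)" using that by simp
    then obtain b where b: "\<forall>n. b n \<in> range F" "b \<longlonglongrightarrow> y"
      by (elim closure_sequential[THEN iffD1, elim_format] exE conjE)
    from b(1) have "\<forall>n. \<exists>a. b n = F a" by blast
    then obtain a where "\<forall>n. b n = F (a n)" by metis
    then have "b = (\<lambda>n. F (a n))" by (intro ext) blast
    then show ?thesis using b(2) by (intro exI[of _ a]) simp
  qed
  \<comment> \<open>Used in both directions: with \<open>F = A\<close> and \<open>G = S\<close> to
    define \<open>U\<close>, and with the roles exchanged to find preimages under
    \<open>U\<close>.\<close>
  have conv: "\<exists>l. (\<lambda>n. G (a n)) \<longlonglongrightarrow> l"
    if "\<And>x y. dist (F x) (F y) = dist (G x) (G y)" "(\<lambda>n. F (a n)) \<longlonglongrightarrow> l'" for F G :: "'a \<Rightarrow> 'a" and a l'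
  proof -
    have "Cauchy (\<lambda>n. G (a n))"
      using LIMSEQ_imp_Cauchy[OF that(2)] unfolding Cauchy_def that(1) .
    then show ?thesis using Cauchy_convergent convergent_def by blast
  qed
  obtain a where a: "\<And>y. (\<lambda>n. A (a y n)) \<longlonglongrightarrow> y" using app[OF dA] by metis
  have "\<exists>l. (\<lambda>n. S (a y n)) \<longlonglongrightarrow> l" for y by (rule conv[OF dist a])
  then obtain U where U: "\<And>y. (\<lambda>n. S (a y n)) \<longlonglongrightarrow> U y" by metis
  \<comment> \<open>The limit does not depend on the approximating sequence, so sums and multiples
    of chosen sequences may be used for linearity.\<close>
  have key: "(\<lambda>n. S (b n)) \<longlonglongrightarrow> U y" if "(\<lambda>n. A (b n)) \<longlonglongrightarrow> y" for b y
  proof -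
    have "(\<lambda>n. dist (A (b n)) (A (a y n))) \<longlonglongrightarrow> dist y y" by (intro tendsto_dist that a)
    then have "(\<lambda>n. norm (S (b n) - S (a y n))) \<longlonglongrightarrow> 0" by (simp add: dist flip: dist_norm)
    then have "(\<lambda>n. S (b n) - S (a y n)) \<longlonglongrightarrow> 0"
      by (rule tendsto_norm_zero_cancel)
    from tendsto_add[OF this U[of y]] show ?thesis by simp
  qed
  have inner: "cinner (U x) (U y) = cinner x y" for x y
    using LIMSEQ_unique[OF cinner.tendsto[OF U[of x] U[of y]]] cinner.tendsto[OF a[of x] a[of y]]
    by (simp add: eq)
  have UA: "U (A x) = S x" for x
    using key[of "\<lambda>n. x" "A x"] by (simp add: LIMSEQ_const_iff)
  have "U \<in> bounded_ops"
  proof (rule bounded_opsI)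
    fix x y
    have "(\<lambda>n. A (a x n + a y n)) \<longlonglongrightarrow> x + y" by (simp add: bounded_opsD(3)[OF A] tendsto_add a)
    from key[OF this] have "(\<lambda>n. S (a x n) + S (a y n)) \<longlonglongrightarrow> U (x + y)"
      by (simp add: bounded_opsD(3)[OF S])
    then show "U (x + y) = U x + U y" using LIMSEQ_unique tendsto_add[OF U[of x] U[of y]] by blast
  next
    fix c x
    have "(\<lambda>n. A (c *\<^sub>C a x n)) \<longlonglongrightarrow> c *\<^sub>C x" by (simp add: bounded_opsD(2)[OF A] scaleC.tendsto a)
    from key[OF this] have "(\<lambda>n. c *\<^sub>C S (a x n)) \<longlonglongrightarrow> U (c *\<^sub>C x)"
      by (simp add: bounded_opsD(2)[OF S])
    then show "U (c *\<^sub>C x) = c *\<^sub>C U x"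
      using LIMSEQ_unique scaleC.tendsto[OF tendsto_const U[of x]] by blast
  next
    fix x
    show "norm (U x) \<le> 1 * norm x"
      using inner[of x x] by (metis Re_cinner_self mult_1 norm_ge_zero order_refl power2_eq_imp_eq)
  qed
  moreover have "surj U"
  proof -
    have "\<exists>y. U y = z" for z
    proof -
      obtain b where b: "(\<lambda>n. S (b n)) \<longlonglongrightarrow> z" using app[OF dS] by blast
      obtain y where "(\<lambda>n. A (b n)) \<longlonglongrightarrow> y" using conv[OF dist[symmetric] b] by blast
      then show ?thesis using key b LIMSEQ_unique by blast
    qed
    then show ?thesis by (metis surjI)
  qed
  ultimately show ?thesis using UA inner by blast
qed

text \<open>With \<open>P = S' S\<close> and \<open>Q = 1 - P\<close>, a fixed point
  \<open>R\<close> of the square root iteration makes \<open>A = 1 - R\<close> the modulus of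
  \<open>S\<close>. The unitary \<open>U\<close> with \<open>U A = S\<close> then satisfies
  \<open>Re (cinner (U x) (S x)) = Re (cinner x (A x))\<close>.\<close>

lemma polar_decomposition_contraction:
  fixes S :: "'a::chilbert_space \<Rightarrow> 'a"
  assumes S: "S \<in> bounded_ops" and le: "\<And>x. norm (S x) \<le> norm x"
    and inj: "inj S" and dS: "closure (range S) = UNIV"
  shows "\<exists>U\<in>bounded_ops. surj U \<and> (\<forall>x. norm (U x) = norm x) \<and>
    (\<forall>x. Re (cinner (U x) (S x)) \<ge> (norm (S x))\<^sup>2 / 2)"
proof -
  obtain S' where S': "S' \<in> bounded_ops" "\<And>x y. cinner (S x) y = cinner x (S' y)"
    using adjoint_exists[OF S] by blast
  have S'2: "cinner x (S y) = cinner (S' x) y" for x y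
    by (metis S'(2) cinner_commute)
  define P where "P x = S' (S x)" for x
  have P: "P \<in> bounded_ops" unfolding P_def by (rule bounded_ops_comp[OF S'(1) S])
  have PS: "cinner (P x) y = cinner (S x) (S y)" "cinner x (P y) = cinner (S x) (S y)" for x y
    by (simp_all only: P_def S'2[symmetric] S'(2))
  have Ple: "norm (P x) \<le> norm (S x)" for x
  proof -
    have "(norm (P x))\<^sup>2 = Re (cinner (S x) (S (P x)))" by (simp flip: PS(1))
    also have "\<dots> \<le> norm (S x) * norm (S (P x))"
      using cinner_Cauchy_Schwarz complex_Re_le_cmod order_trans by blast
    also have "\<dots> \<le> norm (S x) * norm (P x)" by (intro mult_left_mono le) auto
    finally show ?thesis by (cases "P x = 0") (auto simp: power2_eq_square mult_le_cancel_right)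
  qed
  define Q where "Q x = x - P x" for x
  have Qle: "norm (Q x) \<le> norm x" for x
  proof -
    have "(norm (Q x))\<^sup>2 = (norm x)\<^sup>2 - 2 * (norm (S x))\<^sup>2 + (norm (P x))\<^sup>2"
      unfolding Q_def norm_diff_sq PS by simp
    also have "\<dots> \<le> (norm x)\<^sup>2" using power_mono[OF Ple[of x], of 2] zero_le_power2[of "norm (S x)"] norm_ge_zero[of "P x"] by linarith
    finally show ?thesis by (simp add: power2_le_iff_abs_le)
  qed
  have "Q \<in> bounded_ops"
    by (rule bounded_opsI[where K=1])
      (auto simp: Q_def bounded_opsD[OF P] scaleC.diff_right Qle[unfolded Q_def])
  then obtain R where R: "R \<in> bounded_ops" "\<And>x. norm (R x) \<le> norm x"
      "\<And>x y. cinner (R x) y = cinner x (R y)" "\<And>x. Q x + R (R x) = R x + R x"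
    using sqrt_fixed_point[of Q] Qle by (auto simp: Q_def cinner_diff_left cinner_diff_right PS)
  define A where "A x = x - R x" for x
  have A: "A \<in> bounded_ops"
  proof (rule bounded_opsI[where K=2])
    show "norm (A x) \<le> 2 * norm x" for x
      using norm_triangle_ineq4[of x "R x"] R(2)[of x] by (simp add: A_def)
  qed (auto simp: A_def bounded_opsD[OF R(1)] scaleC.diff_right)
  have Asym: "cinner (A x) y = cinner x (A y)" for x y
    by (simp add: A_def cinner_diff_left cinner_diff_right R(3))
  have "A (A x) = P x" for x
    using R(4)[of x] by (simp add: A_def Q_def bounded_opsD[OF R(1)] algebra_simps)
  then have AS: "cinner (A x) (A y) = cinner (S x) (S y)" for x y
    using Asym[of "A x" y] PS(1) by simp
  then have An: "norm (A x) = norm (S x)" for x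
    by (metis Re_cinner_self norm_ge_zero power2_eq_imp_eq)
  \<comment> \<open>The range of \<open>A\<close> is dense: a vector orthogonal to it is killed by
    the symmetric \<open>A\<close>, hence by \<open>S\<close>, because \<open>A x\<close> and
    \<open>S x\<close> have equal norms; \<open>S\<close> is injective.\<close>
  have "csubspace (range A)"
    unfolding csubspace_def
    using bounded_opsD(5)[OF A] by (auto simp flip: bounded_opsD(2,3)[OF A] intro: range_eqI[of _ _ 0])
  then have sub: "csubspace (closure (range A))" by (rule csubspace_closure)
  have "x \<in> closure (range A)" for x
  proof -
    obtain m where m: "m \<in> closure (range A)" "\<And>v. v \<in> closure (range A) \<Longrightarrow> cinner (x - m) v = 0"
      using orthogonal_projection_exists[OF closed_closure sub] by blast
    have "cinner (A (x - m)) y = 0" for y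
      unfolding Asym by (rule m(2)[OF subsetD[OF closure_subset rangeI]])
    then have "A (x - m) = 0" by (rule cinner_eq_0_all)
    then have "S (x - m) = S 0" using An[of "x - m"] by (simp add: bounded_opsD(5)[OF S])
    then have "x - m = 0" by (rule injD[OF inj])
    then show ?thesis using m(1) by simp
  qed
  then have dA: "closure (range A) = UNIV" by blast
  obtain U where U: "U \<in> bounded_ops" "surj U" "\<And>x. U (A x) = S x"
      "\<And>x y. cinner (U x) (U y) = cinner x y"
    using isometric_extension[OF A S AS dA dS] by blast
  have "norm (U x) = norm x" for x
    using U(4)[of x x] by (metis Re_cinner_self norm_ge_zero power2_eq_imp_eq)
  \<comment> \<open>Expanding \<open>norm (x - R x)\<close> and using that \<open>R\<close> is a
    contraction bounds the squared norm of \<open>A x\<close> by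
    \<open>2 * Re (cinner x (A x))\<close>.\<close>
  moreover have "Re (cinner (U x) (S x)) \<ge> (norm (S x))\<^sup>2 / 2" for x
  proof -
    have 1: "Re (cinner (U x) (S x)) = (norm x)\<^sup>2 - Re (cinner x (R x))"
      using U(4)[of x "A x"] unfolding U(3) by (simp add: A_def cinner_diff_right)
    have "(norm (S x))\<^sup>2 = (norm x)\<^sup>2 - 2 * Re (cinner x (R x)) + (norm (R x))\<^sup>2"
      unfolding An[symmetric] by (simp add: A_def norm_diff_sq)
    moreover have "(norm (R x))\<^sup>2 \<le> (norm x)\<^sup>2" by (intro power_mono R) auto
    ultimately show ?thesis unfolding 1 by simp
  qed
  ultimately show ?thesis using U by blast
qed

section \<open>Resolvent sets\<close>

lemma linear_operatorD:
  assumes "linear_operator D S"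
  shows "0 \<in> D" "S 0 = 0"
    "x \<in> D \<Longrightarrow> y \<in> D \<Longrightarrow> x + y \<in> D" "x \<in> D \<Longrightarrow> y \<in> D \<Longrightarrow> S (x + y) = S x + S y"
    "x \<in> D \<Longrightarrow> c *\<^sub>C x \<in> D" "x \<in> D \<Longrightarrow> S (c *\<^sub>C x) = c *\<^sub>C S x"
    "x \<in> D \<Longrightarrow> y \<in> D \<Longrightarrow> x - y \<in> D" "x \<in> D \<Longrightarrow> y \<in> D \<Longrightarrow> S (x - y) = S x - S y"
proof -
  show 1: "0 \<in> D" and 2: "\<And>x y. x \<in> D \<Longrightarrow> y \<in> D \<Longrightarrow> x + y \<in> D"
    and 3: "\<And>x y. x \<in> D \<Longrightarrow> y \<in> D \<Longrightarrow> S (x + y) = S x + S y"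
    and 4: "\<And>c x. x \<in> D \<Longrightarrow> c *\<^sub>C x \<in> D" and 5: "\<And>c x. x \<in> D \<Longrightarrow> S (c *\<^sub>C x) = c *\<^sub>C S x"
    using assms by (auto simp: linear_operator_def)
  show "S 0 = 0" using 5[OF 1, of 0] by (simp add: scaleC.zero_left)
  show "x \<in> D \<Longrightarrow> y \<in> D \<Longrightarrow> x - y \<in> D"
    using 2[of x "- y"] 4[of y "-1"] by (simp add: scaleC_minus_one)
  show "x \<in> D \<Longrightarrow> y \<in> D \<Longrightarrow> S (x - y) = S x - S y"
    using 3[of x "- y"] 4[of y "-1"] 5[of y "-1"] by (simp add: scaleC_minus_one)
qed

lemma linear_operator_shift:
  "linear_operator D S \<Longrightarrow> linear_operator D (\<lambda>x. S x - z *\<^sub>C x)"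
  unfolding linear_operator_def
  by (simp add: scaleC_add_right scaleC.diff_right scaleC_scaleC mult.commute algebra_simps)

lemma bounded_ops_linear_operator: "B \<in> bounded_ops \<Longrightarrow> linear_operator UNIV B"
  by (simp add: linear_operator_def bounded_opsD)

text \<open>\<open>T - z\<close> inherits closedness from \<open>T\<close>: adding the convergent
  sequence \<open>z *\<^sub>C x n\<close> gives a convergent sequence in the graph of
  \<open>T\<close>.\<close>

lemma closed_operator_limit:
  assumes T: "closed_operator D T" and x: "\<And>n. x n \<in> D" "x \<longlonglongrightarrow> l"
    and lim: "(\<lambda>n. T (x n) - z *\<^sub>C x n) \<longlonglongrightarrow> m"
  shows "l \<in> D" "T l - z *\<^sub>C l = m"
proof -
  have "(\<lambda>n. T (x n) - z *\<^sub>C x n + z *\<^sub>C x n) \<longlonglongrightarrow> m + z *\<^sub>C l"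
    by (intro tendsto_add lim scaleC.tendsto tendsto_const x)
  then have "(\<lambda>n. (x n, T (x n))) \<longlonglongrightarrow> (l, m + z *\<^sub>C l)"
    by (intro tendsto_Pair x) simp
  then have "(l, m + z *\<^sub>C l) \<in> (\<lambda>x. (x, T x)) ` D"
    using T x unfolding closed_operator_def
    by (metis (mono_tags, lifting) closed_sequentially image_eqI)
  then have "l \<in> D" "m + z *\<^sub>C l = T l" by auto
  then show "l \<in> D" "T l - z *\<^sub>C l = m" by (simp_all flip: \<open>m + z *\<^sub>C l = T l\<close>)
qed

lemma lower_bound_from_unit_vectors:
  assumes S: "linear_operator D S" and c: "\<And>x. x \<in> D \<Longrightarrow> norm x = 1 \<Longrightarrow> c \<le> norm (S x)"
    and x: "x \<in> D"
  shows "c * norm x \<le> norm (S x)"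
proof (cases "x = 0")
  case False
  define a where "a = complex_of_real (1 / norm x)"
  have "c \<le> norm (S (a *\<^sub>C x))"
    by (intro c linear_operatorD(5)[OF S] x) (use False in \<open>simp add: a_def norm_scaleC norm_divide\<close>)
  also have "\<dots> = norm (S x) / norm x"
    by (simp add: linear_operatorD(6)[OF S x] norm_scaleC a_def norm_divide)
  finally show ?thesis using False by (simp add: field_simps)
qed simp

text \<open>The lower bound \<open>c\<close> makes \<open>S - z\<close> injective and bounds its
  inverse by \<open>1 / c\<close>.\<close>

lemma resolvent_setI:
  assumes S: "linear_operator D S" and surj: "\<And>y. \<exists>x\<in>D. S x - z *\<^sub>C x = y"
    and c: "c > 0" "\<And>x. x \<in> D \<Longrightarrow> c * norm x \<le> norm (S x - z *\<^sub>C x)"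
  shows "z \<in> resolvent_set D S"
proof -
  let ?M = "\<lambda>x. S x - z *\<^sub>C x" and ?r = "resolvent D S z"
  note M = linear_operatorD[OF linear_operator_shift[OF S, of z]]
  have inj: "inj_on ?M D"
  proof (rule inj_onI)
    fix x y assume xy: "x \<in> D" "y \<in> D" "?M x = ?M y"
    then have "c * norm (x - y) \<le> 0" using c(2)[of "x - y"] M(7,8)[of x y] by simp
    then show "x = y" using c(1) by (simp add: mult_le_0_iff)
  qed
  have im: "?M ` D = UNIV" using surj by (metis (mono_tags, lifting) UNIV_eq_I image_eqI)
  have r: "?r y \<in> D" "?M (?r y) = y" for y
    using inv_into_into[of y ?M D] f_inv_into_f[of y ?M D] im by (simp_all add: resolvent_def)
  have eq: "?r y = x" if "x \<in> D" "?M x = y" for x y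
    using inj_onD[OF inj, of "?r y" x] r that by simp
  have "?r \<in> bounded_ops"
  proof (rule bounded_opsI)
    show "?r (x + y) = ?r x + ?r y" for x y
      by (rule eq) (simp_all add: M(3) r M(4)[OF r(1) r(1)])
    show "?r (a *\<^sub>C x) = a *\<^sub>C ?r x" for a x
      by (rule eq) (simp_all add: M(5) r M(6)[OF r(1)])
    show "norm (?r x) \<le> (1 / c) * norm x" for x
      using c(2)[OF r(1), of x] c(1) unfolding r(2) by (simp add: field_simps)
  qed
  then show ?thesis using inj im by (simp add: resolvent_set_def bij_betw_def)
qed

lemma resolvent_setD:
  assumes "z \<in> resolvent_set D S"
  shows "resolvent D S z \<in> bounded_ops" "resolvent D S z y \<in> D"
    "S (resolvent D S z y) - z *\<^sub>C resolvent D S z y = y"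
    "x \<in> D \<Longrightarrow> resolvent D S z (S x - z *\<^sub>C x) = x"
proof -
  let ?M = "\<lambda>x. S x - z *\<^sub>C x"
  have bij: "bij_betw ?M D UNIV" and r: "resolvent D S z \<in> bounded_ops"
    using assms by (auto simp: resolvent_set_def)
  show "resolvent D S z \<in> bounded_ops" by (rule r)
  have im: "?M ` D = UNIV" and inj: "inj_on ?M D" using bij by (auto simp: bij_betw_def)
  show "resolvent D S z y \<in> D" "?M (resolvent D S z y) = y"
    using inv_into_into[of y ?M D] f_inv_into_f[of y ?M D] im by (simp_all add: resolvent_def)
  show "x \<in> D \<Longrightarrow> resolvent D S z (?M x) = x"
    using inv_into_f_f[OF inj] by (simp add: resolvent_def)
qed

text \<open>Solving \<open>(S - z) x = y\<close> amounts to a fixed point of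
  \<open>x \<mapsto> (S - w)^{-1} (y + (z - w) x)\<close>, a contraction with constant
  \<open>dist z w / c\<close>. The lower bound survives as \<open>c - dist z w\<close>.\<close>

lemma resolvent_set_ball:
  assumes S: "linear_operator D S" and w: "w \<in> resolvent_set D S"
    and c: "\<And>x. x \<in> D \<Longrightarrow> c * norm x \<le> norm (S x - w *\<^sub>C x)" and z: "dist z w < c"
  shows "z \<in> resolvent_set D S"
proof -
  let ?r = "resolvent D S w"
  have c0: "c > 0" using z zero_le_dist[of z w] by linarith
  note r = resolvent_setD[OF w]
  have rb: "norm (?r y) \<le> norm y / c" for y
    using c[OF r(2), of y] c0 unfolding r(3) by (simp add: field_simps)
  have "\<exists>x\<in>D. S x - z *\<^sub>C x = y" for y
  proof -
    define g where "g x = ?r (y + (z - w) *\<^sub>C x)" for x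
    have "dist (g a) (g b) \<le> (dist z w / c) * dist a b" for a b
    proof -
      have "g a - g b = ?r ((z - w) *\<^sub>C (a - b))"
        by (simp add: g_def scaleC.diff_right flip: bounded_opsD(4)[OF r(1)])
      then show ?thesis using rb[of "(z - w) *\<^sub>C (a - b)"] by (simp add: dist_norm norm_scaleC)
    qed
    moreover have "dist z w / c < 1" "0 \<le> dist z w / c" using z c0 by auto
    ultimately obtain x where x: "g x = x" using banach_fix_type[of "dist z w / c" g] by blast
    have "x \<in> D" using r(2)[of "y + (z - w) *\<^sub>C x"] x by (simp add: g_def)
    moreover have "S x - w *\<^sub>C x = y + (z - w) *\<^sub>C x"
      using r(3)[of "y + (z - w) *\<^sub>C x"] x by (simp add: g_def)
    ultimately show ?thesis by (intro bexI[of _ x]) (auto simp: scaleC.diff_left algebra_simps)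
  qed
  moreover have "(c - dist z w) * norm x \<le> norm (S x - z *\<^sub>C x)" if "x \<in> D" for x
  proof -
    have "norm (S x - w *\<^sub>C x) \<le> norm (S x - z *\<^sub>C x) + norm ((z - w) *\<^sub>C x)"
      using norm_triangle_ineq[of "S x - z *\<^sub>C x" "(z - w) *\<^sub>C x"] by (simp add: scaleC.diff_left)
    then show ?thesis using c[OF that] by (simp add: norm_scaleC dist_norm algebra_simps)
  qed
  ultimately show ?thesis using z by (intro resolvent_setI[OF S, of z "c - dist z w"]) auto
qed

text \<open>The lower bounds make \<open>\<Omega> \<inter> resolvent_set D S\<close> both open and closed in \<open>\<Omega>\<close>.\<close>

lemma connected_subset_resolvent_set:
  assumes S: "linear_operator D S" and conn: "connected \<Omega>" and ne: "\<Omega> \<inter> resolvent_set D S \<noteq> {}"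
    and low: "\<And>z. z \<in> \<Omega> \<Longrightarrow> \<exists>c>0. \<forall>x\<in>D. c * norm x \<le> norm (S x - z *\<^sub>C x)"
  shows "\<Omega> \<subseteq> resolvent_set D S"
proof (rule ccontr)
  let ?\<rho> = "resolvent_set D S"
  assume not: "\<not> \<Omega> \<subseteq> ?\<rho>"
  obtain c where c0: "\<And>z. z \<in> \<Omega> \<Longrightarrow> c z > 0"
    and c: "\<And>z x. z \<in> \<Omega> \<Longrightarrow> x \<in> D \<Longrightarrow> c z * norm x \<le> norm (S x - z *\<^sub>C x)"
    using low by metis
  \<comment> \<open>The radii are halved so that at a common point \<open>u\<close> of a ball around
    \<open>v\<close> in the resolvent set and a ball around \<open>w\<close> outside it, the lower
    bound \<open>c w / 2\<close> still holds and exceeds \<open>dist w u\<close>. Membership then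
    passes from \<open>v\<close> to \<open>u\<close> and on to \<open>w\<close>.\<close>
  define U V where "U = (\<Union>w\<in>\<Omega> \<inter> ?\<rho>. ball w (c w / 2))" and "V = (\<Union>w\<in>\<Omega> - ?\<rho>. ball w (c w / 2))"
  have self: "w \<in> ball w (c w / 2)" if "w \<in> \<Omega>" for w using c0[OF that] by simp
  have False if u: "u \<in> U" "u \<in> V" for u
  proof -
    obtain v w where v: "v \<in> \<Omega>" "v \<in> ?\<rho>" "dist v u < c v / 2"
      and w: "w \<in> \<Omega>" "w \<notin> ?\<rho>" "dist w u < c w / 2"
      using u by (auto simp: U_def V_def)
    have "u \<in> ?\<rho>"
      by (rule resolvent_set_ball[OF S v(2) c[OF v(1)]])
        (use v c0[OF v(1)] in \<open>simp_all add: dist_commute\<close>)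
    moreover have "(c w / 2) * norm x \<le> norm (S x - u *\<^sub>C x)" if x: "x \<in> D" for x
    proof -
      have "norm (S x - w *\<^sub>C x) \<le> norm (S x - u *\<^sub>C x) + norm ((u - w) *\<^sub>C x)"
        using norm_triangle_ineq[of "S x - u *\<^sub>C x" "(u - w) *\<^sub>C x"] by (simp add: scaleC.diff_left)
      moreover have "norm ((u - w) *\<^sub>C x) \<le> (c w / 2) * norm x"
        unfolding norm_scaleC using w(3)
        by (intro mult_right_mono) (auto simp: dist_norm norm_minus_commute)
      ultimately show ?thesis using c[OF w(1) x] by simp
    qed
    ultimately have "w \<in> ?\<rho>"
      by (rule resolvent_set_ball[OF S]) (use w in auto)
    then show False using w(2) by blast
  qed
  then have "U \<inter> V \<inter> \<Omega> = {}" by blast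
  moreover have "\<Omega> \<subseteq> U \<union> V" using self unfolding U_def V_def by blast
  moreover have "open U" "open V" by (auto simp: U_def V_def)
  ultimately have "U \<inter> \<Omega> = {} \<or> V \<inter> \<Omega> = {}" using connectedD[OF conn] by blast
  then show False
    using ne not self unfolding U_def V_def by blast
qed

section \<open>Numerical ranges of the pencils\<close>

text \<open>Lets the numerical ranges of the pencil be treated as those of
  \<open>B (T - z)\<close>.\<close>

lemma pencil_eq:
  assumes "B \<in> bounded_ops"
  shows "(B \<circ> T) x - z *\<^sub>C B x = B (T x - z *\<^sub>C x)"
  by (simp add: bounded_opsD(2,4)[OF assms])

text \<open>If \<open>e\<close> is a positive lower bound for the moduli in the numerical range of
  \<open>B (T - z)\<close> and \<open>K\<close> bounds \<open>B\<close>, then Cauchy-Schwarz gives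
  the lower bound \<open>e / K\<close> on unit vectors.\<close>

lemma lower_bound_from_pencil:
  assumes T: "linear_operator D T" and B: "B \<in> bounded_ops"
    and z: "z \<notin> pencil_numerical_range D (B \<circ> T) B"
  shows "\<exists>c>0. \<forall>x\<in>D. c * norm x \<le> norm (T x - z *\<^sub>C x)"
proof -
  obtain e where e: "e > 0"
    "\<And>w. w \<in> numerical_range D (\<lambda>x. (B \<circ> T) x - z *\<^sub>C B x) \<Longrightarrow> e \<le> cmod w"
    using z by (auto simp: pencil_numerical_range_def closure_approachable not_less)
  obtain K where K: "K > 0" "\<And>x. norm (B x) \<le> norm x * K"
    using bounded_linear.pos_bounded[OF bounded_opsD(1)[OF B]] by metis
  have "e / K \<le> norm (T x - z *\<^sub>C x)" if x: "x \<in> D" "norm x = 1" for x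
  proof -
    have "e \<le> cmod (cinner (B (T x - z *\<^sub>C x)) x)"
      using e(2) x unfolding numerical_range_def pencil_eq[OF B] by blast
    also have "\<dots> \<le> norm (B (T x - z *\<^sub>C x))"
      using cinner_Cauchy_Schwarz[of _ x] x(2) by simp
    also have "\<dots> \<le> norm (T x - z *\<^sub>C x) * K" by (rule K)
    finally show ?thesis using K by (simp add: field_simps)
  qed
  then have "e / K * norm x \<le> norm (T x - z *\<^sub>C x)" if "x \<in> D" for x
    using lower_bound_from_unit_vectors[OF linear_operator_shift[OF T]] that by blast
  then show ?thesis using e(1) K(1) by (intro exI[of _ "e / K"]) simp
qed

section \<open>Extended distances and the norm estimate for the resolvent\<close>

lemma ext_dist_nonneg: "0 \<le> ext_dist z M"
  unfolding ext_dist_def by (rule INF_greatest) simp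

lemma ext_dist_le: "w \<in> M \<Longrightarrow> ext_dist z M \<le> ereal (dist z w)"
  unfolding ext_dist_def by (rule INF_lower)

lemma ext_dist_finite:
  assumes "M \<noteq> {}"
  obtains r where "r \<ge> 0" "ext_dist z M = ereal r" "\<And>w. w \<in> M \<Longrightarrow> r \<le> dist z w"
proof -
  obtain w where "w \<in> M" using assms by blast
  from ext_dist_le[OF this, of z] obtain r where r: "ext_dist z M = ereal r"
    using ext_dist_nonneg[of z M] by (cases "ext_dist z M") auto
  then show ?thesis
    using that[OF _ r] ext_dist_nonneg[of z M] ext_dist_le[of _ M z] by simp
qed

lemma resolvent_norm_le:
  fixes D :: "'a::chilbert_space set"
  assumes T: "linear_operator D T" and B: "B \<in> bounded_ops" "B \<noteq> (\<lambda>x. 0)"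
    and z: "z \<in> resolvent_set D T"
  shows "ereal (onorm (resolvent D T z)) \<le> ext_quotient (ereal (onorm B))
    (ext_dist 0 (numerical_range UNIV B) * ext_dist z (pencil_numerical_range D (B \<circ> T) B))"
proof -
  let ?W = "numerical_range UNIV B" and ?P = "pencil_numerical_range D (B \<circ> T) B"
  show ?thesis
  proof (cases "ext_dist 0 ?W * ext_dist z ?P = 0")
    case True
    then show ?thesis by (simp add: ext_quotient_def)
  next
    case ne: False
    note r = resolvent_setD[OF z]
    \<comment> \<open>A unit vector in \<open>D\<close> is needed to see that both ranges are
      nonempty; otherwise an infinite distance could turn the bound into 0. It is obtained by
      normalising the resolvent at a nonzero vector.\<close>
    obtain y where y: "B y \<noteq> 0" using B(2) by blast
    then have y0: "y \<noteq> 0" using bounded_opsD(5)[OF B(1)] by auto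
    have "resolvent D T z y \<noteq> 0"
      using r(3)[of y] y0 linear_operatorD(2)[OF T] by (auto simp: scaleC.zero_right)
    moreover define a where "a = complex_of_real (1 / norm (resolvent D T z y))"
    ultimately have "a *\<^sub>C resolvent D T z y \<in> D" "norm (a *\<^sub>C resolvent D T z y) = 1"
      using linear_operatorD(5)[OF T r(2)] by (auto simp: norm_scaleC norm_divide)
    then obtain x1 where x1: "x1 \<in> D" "norm x1 = 1" by blast
    then have "?W \<noteq> {}" by (auto simp: numerical_range_def)
    then obtain r0 where r0: "r0 \<ge> 0" "ext_dist 0 ?W = ereal r0" "\<And>w. w \<in> ?W \<Longrightarrow> r0 \<le> dist 0 w"
      by (rule ext_dist_finite[where z=0]) blast
    have r0pos: "r0 > 0" using ne r0 by (cases "r0 = 0") (auto simp flip: zero_ereal_def)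
    have Bx: "r0 \<le> cmod (cinner (B x) x)" if "norm x = 1" for x
    proof -
      have "cinner (B x) x \<in> ?W" using that by (auto simp: numerical_range_def)
      then show ?thesis using r0(3) by fastforce
    qed
    \<comment> \<open>For this quotient the value of the pencil at \<open>x\<close> is exactly 0, so
      0 lies in the numerical range itself.\<close>
    have inP: "cinner (B (T x)) x / cinner (B x) x \<in> ?P" if x: "x \<in> D" "norm x = 1" for x
    proof -
      let ?w = "cinner (B (T x)) x / cinner (B x) x"
      have "cinner (B x) x \<noteq> 0" using Bx[OF x(2)] r0pos by auto
      then have "cinner ((B \<circ> T) x - ?w *\<^sub>C B x) x = 0"
        by (simp add: cinner_diff_left cinner_scaleC_left)
      then have "0 \<in> numerical_range D (\<lambda>x. (B \<circ> T) x - ?w *\<^sub>C B x)"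
        using x unfolding numerical_range_def by (metis (mono_tags, lifting) mem_Collect_eq)
      then show ?thesis unfolding pencil_numerical_range_def
        using closure_subset by blast
    qed
    then have "?P \<noteq> {}" using x1 by blast
    then obtain r1 where r1: "r1 \<ge> 0" "ext_dist z ?P = ereal r1" "\<And>w. w \<in> ?P \<Longrightarrow> r1 \<le> dist z w"
      by (rule ext_dist_finite[where z=z]) blast
    have r1pos: "r1 > 0" using ne r1 by (cases "r1 = 0") (auto simp flip: zero_ereal_def)
    note bl = bounded_opsD(1)[OF B(1)]
    have oB: "onorm B > 0" using onorm_pos_lt[OF bl] y by blast
    have unit: "r0 * r1 / onorm B \<le> norm (T x - z *\<^sub>C x)" if x: "x \<in> D" "norm x = 1" for x
    proof -
      let ?w = "cinner (B (T x)) x / cinner (B x) x"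
      have b0: "cinner (B x) x \<noteq> 0" using Bx[OF x(2)] r0pos by auto
      have "r0 * r1 \<le> cmod (cinner (B x) x) * dist z ?w"
        by (intro mult_mono Bx r1(3) inP x) (use r1 in auto)
      also have "\<dots> = cmod (cinner (B x) x * (?w - z))"
        by (simp add: norm_mult dist_norm norm_minus_commute)
      also have "cinner (B x) x * (?w - z) = cinner (B (T x - z *\<^sub>C x)) x"
        using b0 by (simp add: bounded_opsD[OF B(1)] cinner_diff_left cinner_scaleC_left algebra_simps)
      also have "cmod \<dots> \<le> norm (B (T x - z *\<^sub>C x))"
        using cinner_Cauchy_Schwarz[of _ x] x(2) by simp
      also have "\<dots> \<le> onorm B * norm (T x - z *\<^sub>C x)" by (rule onorm[OF bl])
      finally show ?thesis using oB by (simp add: field_simps)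
    qed
    have "onorm (resolvent D T z) \<le> onorm B / (r0 * r1)"
    proof (rule onorm_bound)
      show "0 \<le> onorm B / (r0 * r1)" using oB r0pos r1pos by simp
      fix v
      have "r0 * r1 / onorm B * norm (resolvent D T z v) \<le> norm v"
        using lower_bound_from_unit_vectors[OF linear_operator_shift[OF T] unit r(2)] r(3) by metis
      then show "norm (resolvent D T z v) \<le> onorm B / (r0 * r1) * norm v"
        using oB r0pos r1pos by (simp add: field_simps)
    qed
    then show ?thesis
      using r0pos r1pos by (simp add: ext_quotient_def r0(2) r1(2))
  qed
qed

section \<open>Spectrum and essential spectrum\<close>

lemma cinner_tendsto_0:
  assumes B: "B \<in> bounded_ops" and y: "(\<lambda>n. norm (y n)) \<longlonglongrightarrow> 0"
    and x: "\<And>n::nat. norm (x n) = 1"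
  shows "(\<lambda>n. cinner (B (y n)) (x n)) \<longlonglongrightarrow> 0"
proof (rule Lim_null_comparison)
  have "(\<lambda>n. norm (B (y n))) \<longlonglongrightarrow> norm (B 0)"
    by (intro tendsto_norm bounded_ops_tendsto[OF B] tendsto_norm_zero_cancel[OF y])
  then show "(\<lambda>n. norm (B (y n))) \<longlonglongrightarrow> 0" by (simp add: bounded_opsD(5)[OF B])
  show "\<forall>\<^sub>F n in sequentially. cmod (cinner (B (y n)) (x n)) \<le> norm (B (y n))"
    using cinner_Cauchy_Schwarz[of "B (y _)" "x _"] x by (intro always_eventually) (metis mult.right_neutral)
qed

lemma approx_point_spectrum_subset:
  assumes B: "B \<in> bounded_ops"
  shows "approx_point_spectrum D T \<subseteq> pencil_numerical_range D (B \<circ> T) B"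
proof
  fix z assume "z \<in> approx_point_spectrum D T"
  then obtain x where x: "\<And>n. x n \<in> D" "\<And>n. norm (x n) = 1"
    and lim: "(\<lambda>n. norm (T (x n) - z *\<^sub>C x n)) \<longlonglongrightarrow> 0"
    by (auto simp: approx_point_spectrum_def)
  have "(\<lambda>n. cinner (B (T (x n) - z *\<^sub>C x n)) (x n)) \<longlonglongrightarrow> 0"
    by (rule cinner_tendsto_0[OF B lim x(2)])
  moreover have "cinner (B (T (x n) - z *\<^sub>C x n)) (x n) \<in> numerical_range D (\<lambda>x. (B \<circ> T) x - z *\<^sub>C B x)" for n
    using x unfolding numerical_range_def pencil_eq[OF B] by blast
  ultimately show "z \<in> pencil_numerical_range D (B \<circ> T) B"
    unfolding pencil_numerical_range_def closure_sequential mem_Collect_eq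
    by (intro exI[of _ "\<lambda>n. cinner (B (T (x n) - z *\<^sub>C x n)) (x n)"]) simp
qed

lemma ess_spectrum_subset:
  assumes B: "B \<in> bounded_ops"
  shows "ess_spectrum D T \<subseteq> pencil_ess_numerical_range D (B \<circ> T) B"
proof
  fix z assume "z \<in> ess_spectrum D T"
  then obtain x where x: "\<And>n. x n \<in> D" "\<And>n. norm (x n) = 1" and w: "weakly_null x"
    and lim: "(\<lambda>n. norm (T (x n) - z *\<^sub>C x n)) \<longlonglongrightarrow> 0"
    by (auto simp: ess_spectrum_def)
  have "(\<lambda>n. cinner (B (T (x n) - z *\<^sub>C x n)) (x n)) \<longlonglongrightarrow> 0"
    by (rule cinner_tendsto_0[OF B lim x(2)])
  then show "z \<in> pencil_ess_numerical_range D (B \<circ> T) B"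
    unfolding pencil_ess_numerical_range_def ess_numerical_range_def pencil_eq[OF B]
    using x w by blast
qed

text \<open>With the unitary factor \<open>U\<close> of the polar decomposition of the rescaled resolvent \<open>S\<close>, the pencil at
  \<open>x = S y\<close> is a multiple of \<open>\<langle>U y, S y\<rangle>\<close>, which is bounded below by a multiple of \<open>\<parallel>x\<parallel>\<^sup>2\<close>. Density of the
  domain makes \<open>U\<close> surjective.\<close>

lemma resolvent_set_pencil:
  fixes D :: "'a::chilbert_space set"
  assumes z: "z \<in> resolvent_set D T" and T: "linear_operator D T" and D: "closure D = UNIV"
  shows "\<exists>B\<in>bounded_ops. 0 \<in> resolvent_set UNIV B \<and> z \<notin> pencil_numerical_range D (B \<circ> T) B"
proof -
  let ?r = "resolvent D T z"
  note r = resolvent_setD[OF z]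
  obtain K where K: "K > 0" "\<And>x. norm (?r x) \<le> norm x * K"
    using bounded_linear.pos_bounded[OF bounded_opsD(1)[OF r(1)]] by metis
  \<comment> \<open>Dividing by the bound \<open>K\<close> turns the resolvent into a contraction,
    as the polar decomposition requires.\<close>
  define S where "S y = complex_of_real (1 / K) *\<^sub>C ?r y" for y
  have Sle: "norm (S y) \<le> norm y" for y
    using K by (simp add: S_def norm_scaleC norm_divide field_simps)
  have S: "S \<in> bounded_ops"
    by (rule bounded_opsI[where K=1])
      (use Sle in \<open>auto simp: S_def bounded_opsD[OF r(1)] scaleC_add_right scaleC_scaleC mult.commute\<close>)
  have rS: "?r y = complex_of_real K *\<^sub>C S y" for y
    using K(1) by (simp add: S_def scaleC_scaleC)
  have "inj S"
    by (rule injI) (metis r(3) rS)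
  have "D \<subseteq> range S"
  proof
    fix x assume x: "x \<in> D"
    have "S (complex_of_real K *\<^sub>C (T x - z *\<^sub>C x)) = x"
      using K(1) r(4)[OF x] by (simp add: S_def bounded_opsD(2)[OF r(1)] scaleC_scaleC)
    then show "x \<in> range S" by (rule range_eqI[OF sym])
  qed
  then have "closure (range S) = UNIV" using closure_mono[of D "range S"] D by auto
  then obtain U where U: "U \<in> bounded_ops" "surj U" "\<And>x. norm (U x) = norm x"
      "\<And>x. Re (cinner (U x) (S x)) \<ge> (norm (S x))\<^sup>2 / 2"
    using polar_decomposition_contraction[OF S Sle \<open>inj S\<close>] by blast
  have "0 \<in> resolvent_set UNIV U"
  proof (rule resolvent_setI[OF bounded_ops_linear_operator[OF U(1)], of _ 1])
    show "\<exists>x\<in>UNIV. U x - 0 *\<^sub>C x = y" for y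
      using U(2) by (metis UNIV_I diff_zero scaleC.zero_left surjD)
  qed (auto simp: U(3) scaleC.zero_left)
  moreover have "z \<notin> pencil_numerical_range D (U \<circ> T) U"
  proof
    assume "z \<in> pencil_numerical_range D (U \<circ> T) U"
    \<comment> \<open>The threshold is \<open>K * (norm (S ?y))^2 / 2\<close> with
      \<open>norm (S ?y) = 1 / K\<close>, the lower bound for \<open>Re w\<close> found
      below.\<close>
    then obtain w where w: "w \<in> numerical_range D (\<lambda>x. (U \<circ> T) x - z *\<^sub>C U x)" "dist w 0 < 1 / (2 * K)"
      using K(1) closure_approachable[of 0 "numerical_range D (\<lambda>x. (U \<circ> T) x - z *\<^sub>C U x)"]
      unfolding pencil_numerical_range_def mem_Collect_eq
      by (metis zero_less_divide_1_iff zero_less_mult_iff zero_less_numeral)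
    then obtain x where x: "x \<in> D" "norm x = 1" "w = cinner (U (T x - z *\<^sub>C x)) x"
      unfolding numerical_range_def pencil_eq[OF U(1)] by blast
    let ?y = "T x - z *\<^sub>C x"
    have xS: "x = complex_of_real K *\<^sub>C S ?y" using r(4)[OF x(1)] rS by metis
    then have n: "1 = K * norm (S ?y)" using x(2) K(1) by (metis abs_of_pos norm_of_real norm_scaleC)
    have "w = complex_of_real K * cinner (U ?y) (S ?y)"
      unfolding x(3) by (subst (3) xS) (simp add: cinner_scaleC_right)
    then have "Re w = K * Re (cinner (U ?y) (S ?y))" by simp
    also have "\<dots> \<ge> K * ((norm (S ?y))\<^sup>2 / 2)" using U(4)[of ?y] K(1) by (intro mult_left_mono) auto
    also have "K * ((norm (S ?y))\<^sup>2 / 2) = 1 / (2 * K)"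
    proof -
      have "norm (S ?y) = 1 / K" using n K(1) by (simp add: field_simps)
      then show ?thesis using K(1) by (simp add: power2_eq_square)
    qed
    finally show False using w(2) complex_Re_le_cmod[of w] by simp
  qed
  ultimately show ?thesis using U(1) by blast
qed

section \<open>Orthonormal systems and the converse inclusion for the essential spectrum\<close>

lemma cinner_sum_orthonormal:
  assumes "finite I" "\<And>i j. i \<in> I \<Longrightarrow> j \<in> I \<Longrightarrow> cinner (e i) (e j) = (if i = j then 1 else 0)"
    and "j \<in> I"
  shows "cinner (\<Sum>i\<in>I. c i *\<^sub>C e i) (e j) = c j"
proof -
  have "cinner (\<Sum>i\<in>I. c i *\<^sub>C e i) (e j) = (\<Sum>i\<in>I. if i = j then c i else 0)"
    unfolding cinner.sum_left by (intro sum.cong refl) (simp add: cinner_scaleC_left assms)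
  then show ?thesis using assms by simp
qed

text \<open>The right side minus the left side is the squared distance from \<open>y\<close> to its
  projection \<open>p\<close> onto the span.\<close>

lemma Bessel_inequality:
  assumes "finite I" "\<And>i j. i \<in> I \<Longrightarrow> j \<in> I \<Longrightarrow> cinner (e i) (e j) = (if i = j then 1 else 0)"
  shows "(\<Sum>i\<in>I. (cmod (cinner y (e i)))\<^sup>2) \<le> (norm (y::'a::chilbert_space))\<^sup>2"
proof -
  define p where "p = (\<Sum>i\<in>I. cinner y (e i) *\<^sub>C e i)"
  have yp: "cinner y p = complex_of_real (\<Sum>i\<in>I. (cmod (cinner y (e i)))\<^sup>2)"
    by (simp add: p_def cinner.sum_right cinner_scaleC_right complex_norm_square mult.commute del: of_real_power)
  have "cinner p p = (\<Sum>i\<in>I. cnj (cinner y (e i)) * cinner p (e i))"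
    by (subst (2) p_def) (simp add: cinner.sum_right cinner_scaleC_right)
  also have "\<dots> = (\<Sum>i\<in>I. cnj (cinner y (e i)) * cinner y (e i))"
    unfolding p_def using cinner_sum_orthonormal[OF assms] by (intro sum.cong) auto
  also have "\<dots> = cinner y p" by (simp add: p_def cinner.sum_right cinner_scaleC_right)
  finally have "(norm p)\<^sup>2 = Re (cinner y p)" by (metis Re_cinner_self)
  then have "(norm (y - p))\<^sup>2 = (norm y)\<^sup>2 - (\<Sum>i\<in>I. (cmod (cinner y (e i)))\<^sup>2)"
    unfolding norm_diff_sq by (simp add: yp)
  then show ?thesis using zero_le_power2[of "norm (y - p)"] by linarith
qed

text \<open>By Bessel's inequality the coefficients of a fixed vector are square summable, hence
  tend to 0.\<close>

lemma orthonormal_weakly_null: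
  assumes "\<And>i j::nat. cinner (e i) (e j) = (if i = j then 1 else 0)"
  shows "weakly_null e"
  unfolding weakly_null_def
proof
  fix y
  have "summable (\<lambda>i. (cmod (cinner y (e i)))\<^sup>2)"
    by (rule summableI_nonneg_bounded[where x="(norm y)\<^sup>2"])
      (use assms in \<open>auto intro: Bessel_inequality\<close>)
  then have "(\<lambda>i. (cmod (cinner y (e i)))\<^sup>2) \<longlonglongrightarrow> 0" by (rule summable_LIMSEQ_zero)
  then have "(\<lambda>i. sqrt ((cmod (cinner y (e i)))\<^sup>2)) \<longlonglongrightarrow> sqrt 0" by (rule tendsto_real_sqrt)
  moreover have "cmod (cinner y (e i)) = cmod (cinner (e i) y)" for i
    by (metis cinner_commute complex_mod_cnj)
  ultimately show "(\<lambda>i. cinner (e i) y) \<longlonglongrightarrow> 0"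
    by (simp add: tendsto_norm_zero_iff)
qed

text \<open>Otherwise an orthonormal singular sequence could be chosen step by step.\<close>

lemma lower_bound_off_ess_spectrum:
  fixes T :: "'a::chilbert_space \<Rightarrow> 'a"
  assumes T: "linear_operator D T" and z: "z \<notin> ess_spectrum D T"
  shows "\<exists>F c. finite F \<and> F \<subseteq> D \<and> (\<forall>e\<in>F. \<forall>f\<in>F. cinner e f = (if e = f then 1 else 0)) \<and> c > 0 \<and>
    (\<forall>x\<in>D. (\<forall>e\<in>F. cinner x e = 0) \<longrightarrow> c * norm x \<le> norm (T x - z *\<^sub>C x))"
proof (rule ccontr)
  assume neg: "\<not> ?thesis"
  let ?M = "\<lambda>x. T x - z *\<^sub>C x"
  \<comment> \<open>If there were no such unit vector, scaling within the orthogonal complement of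
    \<open>F\<close> in \<open>D\<close> would give the lower bound excluded by
    \<open>neg\<close>.\<close>
  have ex: "\<exists>x\<in>D. norm x = 1 \<and> (\<forall>e\<in>F. cinner x e = 0) \<and> norm (?M x) < c"
    if F: "finite F" "F \<subseteq> D" "\<forall>e\<in>F. \<forall>f\<in>F. cinner e f = (if e = f then 1 else 0)" and c: "c > 0" for F c
  proof (rule ccontr)
    assume neg1: "\<not> ?thesis"
    let ?D = "{x\<in>D. \<forall>e\<in>F. cinner x e = 0}"
    have "linear_operator ?D T"
      using T unfolding linear_operator_def
      by (simp add: cinner_add_left cinner_scaleC_left cinner.zero_left)
    moreover have "c \<le> norm (?M x)" if "x \<in> ?D" "norm x = 1" for x
      using neg1 that by force
    ultimately have "c * norm x \<le> norm (?M x)" if "x \<in> ?D" for x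
      using lower_bound_from_unit_vectors[OF linear_operator_shift] that by blast
    then have "\<forall>x\<in>D. (\<forall>e\<in>F. cinner x e = 0) \<longrightarrow> c * norm x \<le> norm (?M x)"
      by blast
    then show False using neg F c by blast
  qed
  \<comment> \<open>The \<open>n\<close>-th vector is constrained only by its predecessors, which is
    the form of dependent choice used next; the bounds tend to 0, so the sequence is
    singular.\<close>
  define P where "P = (\<lambda>(f::nat \<Rightarrow> 'a) n x. x \<in> D \<and> norm x = 1 \<and> (\<forall>k<n. cinner x (f k) = 0) \<and>
    norm (?M x) < inverse (real (Suc n)))"
  have "\<exists>f. \<forall>n. P f n (f n)"
  proof (rule dependent_wellorder_choice)
    fix x n and f g :: "nat \<Rightarrow> 'a"
    assume "\<And>k. k < n \<Longrightarrow> f k = g k"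
    then show "P f n x = P g n x" by (simp add: P_def)
  next
    fix n and f :: "nat \<Rightarrow> 'a"
    assume f: "\<And>k. k < n \<Longrightarrow> P f k (f k)"
    have orth: "cinner (f i) (f j) = 0" if "i < n" "j < n" "i \<noteq> j" for i j
    proof (cases "i < j")
      case True
      then have "cinner (f j) (f i) = 0" using f[OF that(2)] by (simp add: P_def)
      then show ?thesis by (metis cinner_commute complex_cnj_zero)
    next
      case False
      then show ?thesis using f[OF that(1)] that(3) by (simp add: P_def)
    qed
    have self: "cinner (f i) (f i) = 1" if "i < n" for i
      using f[OF that] by (simp add: P_def cinner_self)
    have "\<exists>x\<in>D. norm x = 1 \<and> (\<forall>e\<in>f ` {..<n}. cinner x e = 0) \<and> norm (?M x) < inverse (real (Suc n))"
    proof (rule ex)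
      show "f ` {..<n} \<subseteq> D" using f by (auto simp: P_def)
      show "\<forall>e\<in>f ` {..<n}. \<forall>f\<in>f ` {..<n}. cinner e f = (if e = f then 1 else 0)"
        using self orth by fastforce
    qed auto
    then show "\<exists>x. P f n x" unfolding P_def by auto
  qed
  then obtain f where "\<And>n. P f n (f n)" by blast
  then have f: "f n \<in> D" "norm (f n) = 1" "k < n \<Longrightarrow> cinner (f n) (f k) = 0"
    "norm (?M (f n)) < inverse (real (Suc n))" for k n
    by (auto simp: P_def)
  have "cinner (f i) (f j) = (if i = j then 1 else 0)" for i j
  proof (cases i j rule: linorder_cases)
    case less
    then show ?thesis using f(3)[OF less] by (metis cinner_commute complex_cnj_zero nat_neq_iff)
  qed (use f in \<open>auto simp: cinner_self\<close>)
  then have "weakly_null f" by (rule orthonormal_weakly_null)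
  moreover have "(\<lambda>n. norm (?M (f n))) \<longlonglongrightarrow> 0"
    by (rule tendsto_sandwich[OF _ _ tendsto_const LIMSEQ_inverse_real_of_nat])
      (use f(4) in \<open>auto intro: always_eventually less_imp_le\<close>)
  ultimately have "z \<in> ess_spectrum D T"
    using f unfolding ess_spectrum_def by blast
  then show False using z by blast
qed

text \<open>Let \<open>E\<close> consist of the vectors in \<open>D\<close> orthogonal to
  \<open>F\<close>. The lower bound and the closedness of \<open>T\<close> make the image of
  \<open>E\<close> under \<open>T - z\<close> closed. \<open>B\<close> projects orthogonally onto
  this image and then inverts \<open>T - z\<close> on \<open>E\<close>.\<close>

lemma bounded_left_inverse:
  fixes T :: "'a::chilbert_space \<Rightarrow> 'a"
  assumes T: "closed_operator D T" and c: "c > 0"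
    and low: "\<And>x. x \<in> D \<Longrightarrow> (\<forall>e\<in>F. cinner x e = 0) \<Longrightarrow> c * norm x \<le> norm (T x - z *\<^sub>C x)"
  shows "\<exists>B\<in>bounded_ops. \<forall>x\<in>D. (\<forall>e\<in>F. cinner x e = 0) \<longrightarrow> B (T x - z *\<^sub>C x) = x"
proof -
  let ?M = "\<lambda>x. T x - z *\<^sub>C x"
  define E where "E = {x\<in>D. \<forall>e\<in>F. cinner x e = 0}"
  have TD: "linear_operator D T" using T by (simp add: closed_operator_def)
  have "linear_operator E T"
    using TD unfolding linear_operator_def E_def
    by (simp add: cinner_add_left cinner_scaleC_left cinner.zero_left)
  note M = linear_operatorD[OF linear_operator_shift[OF this, of z]]
  have lowE: "c * norm x \<le> norm (?M x)" if "x \<in> E" for x using low that by (auto simp: E_def)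
  have sub: "csubspace (?M ` E)"
    unfolding csubspace_def
  proof (intro conjI ballI allI)
    show "0 \<in> ?M ` E" using M(1,2) by force
    show "u + v \<in> ?M ` E" if "u \<in> ?M ` E" "v \<in> ?M ` E" for u v
      using that by (elim imageE) (metis (mono_tags, lifting) M(3,4) image_eqI)
    show "a *\<^sub>C u \<in> ?M ` E" if "u \<in> ?M ` E" for a u
      using that by (elim imageE) (metis (mono_tags, lifting) M(5,6) image_eqI)
  qed
  have "closed (?M ` E)"
    unfolding closed_sequential_limits
  proof (intro allI impI, elim conjE)
    fix y l assume "\<forall>n. y n \<in> ?M ` E" and l: "y \<longlonglongrightarrow> l"
    then have "\<forall>n. \<exists>x. x \<in> E \<and> y n = ?M x" by blast
    then obtain x where x: "\<And>n. x n \<in> E" "\<And>n. y n = ?M (x n)" by metis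
    have "Cauchy x"
    proof (rule metric_CauchyI)
      fix e :: real assume "e > 0"
      then obtain N where N: "\<And>m n. m \<ge> N \<Longrightarrow> n \<ge> N \<Longrightarrow> dist (y m) (y n) < c * e"
        using metric_CauchyD[OF LIMSEQ_imp_Cauchy[OF l], of "c * e"] c by auto
      have "dist (x m) (x n) < e" if "m \<ge> N" "n \<ge> N" for m n
      proof -
        have "c * norm (x m - x n) \<le> norm (y m - y n)"
          using lowE[OF M(7)[OF x(1) x(1)], of m n] M(8)[OF x(1) x(1), of m n] by (simp add: x(2))
        then have "c * dist (x m) (x n) < c * e" using N[OF that] by (simp add: dist_norm)
        then show ?thesis using c by simp
      qed
      then show "\<exists>N. \<forall>m\<ge>N. \<forall>n\<ge>N. dist (x m) (x n) < e" by blast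
    qed
    then obtain p where p: "x \<longlonglongrightarrow> p" using Cauchy_convergent convergent_def by blast
    have "(\<lambda>n. ?M (x n)) \<longlonglongrightarrow> l" using l by (simp flip: x(2))
    with x(1) have pD: "p \<in> D" "?M p = l"
      using closed_operator_limit[OF T _ p] by (auto simp: E_def)
    have "cinner p e = 0" if "e \<in> F" for e
    proof -
      have "(\<lambda>n. cinner (x n) e) \<longlonglongrightarrow> cinner p e" by (intro cinner.tendsto p tendsto_const)
      moreover have "cinner (x n) e = 0" for n using x(1) that by (auto simp: E_def)
      ultimately show ?thesis by (simp add: LIMSEQ_const_iff)
    qed
    then have "p \<in> E" using pD by (simp add: E_def)
    then show "l \<in> ?M ` E" using pD(2) by blast
  qed
  then have "\<exists>m\<in>?M ` E. \<forall>v\<in>?M ` E. cinner (y - m) v = 0" for y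
    by (rule orthogonal_projection_exists[OF _ sub])
  then have "\<forall>y. \<exists>x. x \<in> E \<and> (\<forall>v\<in>E. cinner (y - ?M x) (?M v) = 0)" by blast
  then obtain B where B: "\<And>y. B y \<in> E" "\<And>y v. v \<in> E \<Longrightarrow> cinner (y - ?M (B y)) (?M v) = 0" by metis
  \<comment> \<open>Orthogonality of the residual determines \<open>B y\<close> uniquely; linearity
    and the left inverse property both follow by checking it.\<close>
  have eq: "B y = x" if x: "x \<in> E" "\<And>v. v \<in> E \<Longrightarrow> cinner (y - ?M x) (?M v) = 0" for x y
  proof -
    let ?d = "B y - x"
    have d: "?d \<in> E" by (intro M(7) B x)
    have aux: "a - b = (y - b) - (y - a)" for a b :: 'a by simp
    have "?M ?d = (y - ?M x) - (y - ?M (B y))"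
      by (rule trans[OF M(8)[OF B(1) x(1)] aux])
    then have "cinner (?M ?d) (?M ?d) = cinner ((y - ?M x) - (y - ?M (B y))) (?M ?d)"
      by (rule arg_cong)
    also have "\<dots> = 0" by (subst cinner_diff_left) (simp only: B(2)[OF d] x(2)[OF d] diff_zero)
    finally have "norm (?M ?d) = 0" by (simp add: cinner_self)
    then show ?thesis using lowE[OF d] c by (simp add: mult_le_0_iff)
  qed
  have "B \<in> bounded_ops"
  proof (rule bounded_opsI)
    show "B (x + y) = B x + B y" for x y
    proof (rule eq)
      show "B x + B y \<in> E" by (intro M(3) B)
      fix v assume v: "v \<in> E"
      have "x + y - ?M (B x + B y) = (x - ?M (B x)) + (y - ?M (B y))"
        unfolding M(4)[OF B(1) B(1)] by (simp add: algebra_simps)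
      then show "cinner (x + y - ?M (B x + B y)) (?M v) = 0"
        by (simp only: cinner_add_left B(2)[OF v] add_0)
    qed
    show "B (a *\<^sub>C x) = a *\<^sub>C B x" for a x
    proof (rule eq)
      show "a *\<^sub>C B x \<in> E" by (intro M(5) B)
      fix v assume v: "v \<in> E"
      have "a *\<^sub>C x - ?M (a *\<^sub>C B x) = a *\<^sub>C (x - ?M (B x))"
        unfolding M(6)[OF B(1)] by (simp only: scaleC.diff_right)
      then show "cinner (a *\<^sub>C x - ?M (a *\<^sub>C B x)) (?M v) = 0"
        by (simp only: cinner_scaleC_left B(2)[OF v] mult_zero_right)
    qed
    show "norm (B y) \<le> (1 / c) * norm y" for y
    proof -
      let ?m = "?M (B y)"
      \<comment> \<open>The residual \<open>y - ?m\<close> is orthogonal to \<open>?m\<close>, so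
        the projection does not increase the norm.\<close>
      have "cinner ?m ?m = cinner y ?m" using B(2)[OF B(1), of y y] by (simp only: cinner_diff_left[of y ?m ?m]) simp
      then have "(norm ?m)\<^sup>2 = Re (cinner y ?m)" by (metis Re_cinner_self)
      also have "\<dots> \<le> norm y * norm ?m"
        using cinner_Cauchy_Schwarz complex_Re_le_cmod order_trans by blast
      finally have "norm ?m \<le> norm y"
        by (cases "norm ?m = 0") (auto simp: power2_eq_square mult_le_cancel_right)
      then show ?thesis using lowE[OF B(1), of y] c by (simp add: field_simps)
    qed
  qed
  moreover have "B (?M x) = x" if "x \<in> E" for x
    by (rule eq[OF that]) (simp add: cinner.zero_left)
  ultimately show ?thesis by (auto simp: E_def)
qed

text \<open>For the left inverse \<open>B\<close> off a finite orthonormal set,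
  \<open>B (T - z)\<close> is the identity minus a finite-rank term, which disappears along weakly
  null sequences.\<close>

lemma not_in_pencil_ess_numerical_range:
  fixes T :: "'a::chilbert_space \<Rightarrow> 'a"
  assumes T: "closed_operator D T" and z: "z \<notin> ess_spectrum D T"
  shows "\<exists>B\<in>bounded_ops. z \<notin> pencil_ess_numerical_range D (B \<circ> T) B"
proof -
  let ?M = "\<lambda>x. T x - z *\<^sub>C x"
  have TD: "linear_operator D T" using T by (simp add: closed_operator_def)
  note M = linear_operatorD[OF linear_operator_shift[OF TD, of z]]
  obtain F c where F: "finite F" "F \<subseteq> D" "\<And>e f. e \<in> F \<Longrightarrow> f \<in> F \<Longrightarrow> cinner e f = (if e = f then 1 else 0)"
    and c: "c > 0" "\<And>x. x \<in> D \<Longrightarrow> (\<forall>e\<in>F. cinner x e = 0) \<Longrightarrow> c * norm x \<le> norm (?M x)"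
    using lower_bound_off_ess_spectrum[OF TD z] by metis
  obtain B where B: "B \<in> bounded_ops"
    and Binv: "\<And>x. x \<in> D \<Longrightarrow> (\<forall>e\<in>F. cinner x e = 0) \<Longrightarrow> B (?M x) = x"
    using bounded_left_inverse[OF T c] by blast
  have sumD: "(\<Sum>e\<in>G. a e *\<^sub>C e) \<in> D \<and> ?M (\<Sum>e\<in>G. a e *\<^sub>C e) = (\<Sum>e\<in>G. a e *\<^sub>C ?M e)"
    if "finite G" "G \<subseteq> D" for G a
    using that
  proof (induction G)
    case (insert e G)
    then show ?case using M(3)[of "a e *\<^sub>C e"] M(4)[of "a e *\<^sub>C e"] M(5)[of e] M(6)[of e] by simp
  qed (use M(1,2) in simp)
  \<comment> \<open>Subtracting the projection \<open>?p\<close> of \<open>x\<close> onto the span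
    of \<open>F\<close> leaves a vector on which \<open>B\<close> inverts \<open>T - z\<close>. It
    stays in \<open>D\<close> because \<open>F\<close> does.\<close>
  have BM: "B (?M x) = x - (\<Sum>e\<in>F. cinner x e *\<^sub>C (e - B (?M e)))" if x: "x \<in> D" for x
  proof -
    let ?p = "\<Sum>e\<in>F. cinner x e *\<^sub>C e"
    note p = sumD[OF F(1,2), of "\<lambda>e. cinner x e"]
    have "cinner (x - ?p) e = 0" if "e \<in> F" for e
      using cinner_sum_orthonormal[of F "\<lambda>e. e" e "\<lambda>e. cinner x e"] F that by (simp add: cinner_diff_left)
    then have "B (?M (x - ?p)) = x - ?p" using M(7) x p by (intro Binv) auto
    moreover have "?M (x - ?p) = ?M x - (\<Sum>e\<in>F. cinner x e *\<^sub>C ?M e)"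
      using M(8)[OF x, of ?p] p by simp
    moreover have "B (\<Sum>e\<in>F. cinner x e *\<^sub>C ?M e) = (\<Sum>e\<in>F. cinner x e *\<^sub>C B (?M e))"
      by (simp only: linear_sum[OF bounded_linear.linear[OF bounded_opsD(1)[OF B]]] bounded_opsD(2)[OF B])
    ultimately have "B (?M x) - (\<Sum>e\<in>F. cinner x e *\<^sub>C B (?M e)) = x - ?p"
      by (metis bounded_opsD(4)[OF B])
    then show ?thesis by (simp add: scaleC.diff_right sum_subtractf algebra_simps)
  qed
  have "z \<notin> pencil_ess_numerical_range D (B \<circ> T) B"
  proof
    assume "z \<in> pencil_ess_numerical_range D (B \<circ> T) B"
    then obtain x where x: "\<And>n. x n \<in> D" "\<And>n. norm (x n) = 1" and w: "weakly_null x"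
      and lim: "(\<lambda>n. cinner (B (?M (x n))) (x n)) \<longlonglongrightarrow> 0"
      unfolding pencil_ess_numerical_range_def ess_numerical_range_def pencil_eq[OF B] by blast
    have w1: "(\<lambda>n. cinner (x n) y) \<longlonglongrightarrow> 0" for y using w by (simp add: weakly_null_def)
    have w2: "(\<lambda>n. cinner y (x n)) \<longlonglongrightarrow> 0" for y
      using tendsto_cnj[OF w1[of y]] by (simp add: cinner_commute[of y])
    \<comment> \<open>Each summand is a product of two inner products of \<open>x n\<close> with
      fixed vectors, and both factors tend to 0.\<close>
    have "(\<lambda>n. 1 - (\<Sum>e\<in>F. cinner (x n) e * cinner (e - B (?M e)) (x n)))
        \<longlonglongrightarrow> 1 - (\<Sum>e\<in>F. 0 * 0)"
      by (intro tendsto_intros w1 w2)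
    moreover have "cinner (B (?M (x n))) (x n)
        = 1 - (\<Sum>e\<in>F. cinner (x n) e * cinner (e - B (?M e)) (x n))" for n
      unfolding BM[OF x(1)] cinner_diff_left[of "x n"] cinner.sum_left cinner_scaleC_left
      by (simp add: cinner_self x(2))
    ultimately have "(\<lambda>n. cinner (B (?M (x n))) (x n)) \<longlonglongrightarrow> 1" by simp
    with lim show False using LIMSEQ_unique zero_neq_one by blast
  qed
  then show ?thesis using B by blast
qed

theorem theorem4p1:
  fixes D :: "'a::chilbert_space set" and T :: "'a \<Rightarrow> 'a"
  assumes "closed_operator D T"
  shows
    "(approx_point_spectrum D T
        \<subseteq> (\<Inter>B\<in>bounded_ops. pencil_numerical_range D (B \<circ> T) B) \<and>
      (\<Inter>B\<in>bounded_ops. pencil_numerical_range D (B \<circ> T) B)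
        \<subseteq> (\<Inter>B\<in>{B \<in> bounded_ops. 0 \<in> resolvent_set UNIV B}.
              pencil_numerical_range D (B \<circ> T) B) \<and>
      (closure D = UNIV \<longrightarrow>
        (\<Inter>B\<in>{B \<in> bounded_ops. 0 \<in> resolvent_set UNIV B}.
              pencil_numerical_range D (B \<circ> T) B)
          \<subseteq> spectrum D T) \<and>
      ess_spectrum D T = (\<Inter>B\<in>bounded_ops. pencil_ess_numerical_range D (B \<circ> T) B)) \<and>
     (\<forall>\<Lambda> \<Omega>. \<Lambda> \<subseteq> bounded_ops - {\<lambda>x. 0} \<longrightarrow>
        \<Omega> \<subseteq> UNIV - (\<Inter>B\<in>\<Lambda>. pencil_numerical_range D (B \<circ> T) B) \<longrightarrow>
        connected \<Omega> \<longrightarrow>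
        \<Omega> \<inter> resolvent_set D T \<noteq> {} \<longrightarrow>
          \<Omega> \<subseteq> resolvent_set D T \<and>
          (\<forall>z\<in>\<Omega>. ereal (onorm (resolvent D T z))
             \<le> (INF B\<in>\<Lambda>. ext_quotient (ereal (onorm B))
                   (ext_dist 0 (numerical_range UNIV B)
                     * ext_dist z (pencil_numerical_range D (B \<circ> T) B)))))"
proof -
  have T: "linear_operator D T" using assms by (simp add: closed_operator_def)
  have "approx_point_spectrum D T \<subseteq> (\<Inter>B\<in>bounded_ops. pencil_numerical_range D (B \<circ> T) B)"
    using approx_point_spectrum_subset by blast
  moreover have "(\<Inter>B\<in>bounded_ops. pencil_numerical_range D (B \<circ> T) B)
      \<subseteq> (\<Inter>B\<in>{B \<in> bounded_ops. 0 \<in> resolvent_set UNIV B}. pencil_numerical_range D (B \<circ> T) B)"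
    by blast
  moreover have "closure D = UNIV \<longrightarrow>
      (\<Inter>B\<in>{B \<in> bounded_ops. 0 \<in> resolvent_set UNIV B}. pencil_numerical_range D (B \<circ> T) B)
        \<subseteq> spectrum D T"
    unfolding spectrum_def using resolvent_set_pencil[OF _ T] by blast
  moreover have "ess_spectrum D T = (\<Inter>B\<in>bounded_ops. pencil_ess_numerical_range D (B \<circ> T) B)"
    using ess_spectrum_subset not_in_pencil_ess_numerical_range[OF assms] by blast
  moreover have "\<Omega> \<subseteq> resolvent_set D T \<and>
      (\<forall>z\<in>\<Omega>. ereal (onorm (resolvent D T z))
         \<le> (INF B\<in>\<Lambda>. ext_quotient (ereal (onorm B))
               (ext_dist 0 (numerical_range UNIV B)
                 * ext_dist z (pencil_numerical_range D (B \<circ> T) B))))"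
    if \<Lambda>: "\<Lambda> \<subseteq> bounded_ops - {\<lambda>x. 0}"
      and \<Omega>: "\<Omega> \<subseteq> UNIV - (\<Inter>B\<in>\<Lambda>. pencil_numerical_range D (B \<circ> T) B)"
        "connected \<Omega>" "\<Omega> \<inter> resolvent_set D T \<noteq> {}" for \<Lambda> \<Omega>
  proof -
    have "\<Omega> \<subseteq> resolvent_set D T"
    proof (rule connected_subset_resolvent_set[OF T \<Omega>(2,3)])
      fix z assume "z \<in> \<Omega>"
      \<comment> \<open>The operator may vary with \<open>z\<close>; connectedness needs only some
        positive lower bound at each point.\<close>
      then obtain B where "B \<in> \<Lambda>" "z \<notin> pencil_numerical_range D (B \<circ> T) B" using \<Omega>(1) by blast
      then show "\<exists>c>0. \<forall>x\<in>D. c * norm x \<le> norm (T x - z *\<^sub>C x)"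
        using lower_bound_from_pencil[OF T] \<Lambda> by blast
    qed
    then show ?thesis
      using \<Lambda> by (auto intro!: INF_greatest resolvent_norm_le[OF T])
  qed
  ultimately show ?thesis by blast
qed

end
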